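(* Let $X$ be a subspace of the Cantor space. Then $X$ is a $\lambda$-set if and only if the Pixley–Roy hyperspace $\operatorname{PR}(X)$ embeds densely into a first-countable pseudocompact space.
   Context: A subspace $A$ of the Cantor space is a $\lambda$-set if every countable subset of $A$ is a $G_\delta$ subset of $A$. The Pixley–Roy hyperspace $\operatorname{PR}(X)$ is the set of all finite subsets of $X$ with the topology generated by the base of sets $[F,U]=\{A: A \text{ finite}, F\subseteq A\subseteq U\}$, where $F$ is a finite subset of $X$ and $U$ is open in $X$. A space is pseudocompact if it is Tychonoff and every continuous real-valued function on it is bounded. *)

theory Defs
  imports "HOL-Analysis.Analysis"
begin

definition cantor_space :: "(nat \<Rightarrow> bool) topology"
  where "cantor_space = product_topology (\<lambda>_. discrete_topology UNIV) UNIV"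

lemma topspace_cantor_space [simp]: "topspace cantor_space = UNIV"
  by (simp add: cantor_space_def)

definition lambda_set :: "(nat \<Rightarrow> bool) set \<Rightarrow> bool"
  where "lambda_set A \<longleftrightarrow>
    (\<forall>C. C \<subseteq> A \<and> countable C \<longrightarrow> gdelta_in (subtopology cantor_space A) C)"

definition pr_basic :: "'a set \<Rightarrow> 'a set \<Rightarrow> 'a set set"
  where "pr_basic F U = {A. finite A \<and> F \<subseteq> A \<and> A \<subseteq> U}"

(* The empty set is a finite subset of X, hence an (isolated) point of PR(X). *)
definition pixley_roy :: "'a topology \<Rightarrow> 'a set topology"
  where "pixley_roy X = topology_generated_by
    {pr_basic F U | F U. finite F \<and> F \<subseteq> topspace X \<and> openin X U}"

definition tychonoff_space :: "'a topology \<Rightarrow> bool"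
  where "tychonoff_space X \<longleftrightarrow> completely_regular_space X \<and> Hausdorff_space X"

definition pseudocompact_space :: "'a topology \<Rightarrow> bool"
  where "pseudocompact_space X \<longleftrightarrow> tychonoff_space X \<and>
    (\<forall>f. continuous_map X euclideanreal f \<longrightarrow> bounded (f ` topspace X))"

definition embeds_densely :: "'a topology \<Rightarrow> 'b topology \<Rightarrow> bool"
  where "embeds_densely X Y \<longleftrightarrow>
    (\<exists>e. embedding_map X Y e \<and> Y closure_of (e ` topspace X) = topspace Y)"

lemma topspace_pixley_roy: "topspace (pixley_roy X) = {A. finite A \<and> A \<subseteq> topspace X}"
proof
  show "topspace (pixley_roy X) \<subseteq> {A. finite A \<and> A \<subseteq> topspace X}"
    unfolding pixley_roy_def topology_generated_by_topspace pr_basic_def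
    using openin_subset[of X] by blast
  show "{A. finite A \<and> A \<subseteq> topspace X} \<subseteq> topspace (pixley_roy X)"
  proof
    fix A assume A: "A \<in> {A. finite A \<and> A \<subseteq> topspace X}"
    then have "A \<in> pr_basic A (topspace X)" by (simp add: pr_basic_def)
    with A show "A \<in> topspace (pixley_roy X)"
      unfolding pixley_roy_def topology_generated_by_topspace by blast
  qed
qed

(* The sets pr_basic F U form a base, not merely a subbase, of pixley_roy X. *)
lemma openin_pixley_roy:
  "openin (pixley_roy X) W \<longleftrightarrow>
    (\<forall>A\<in>W. \<exists>F U. finite F \<and> F \<subseteq> topspace X \<and> openin X U \<and>
      A \<in> pr_basic F U \<and> pr_basic F U \<subseteq> W)" (is "_ \<longleftrightarrow> ?R W")
proof
  assume "openin (pixley_roy X) W"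
  then have "generate_topology_on {pr_basic F U | F U. finite F \<and> F \<subseteq> topspace X \<and> openin X U} W"
    by (simp add: pixley_roy_def openin_topology_generated_by)
  then show "?R W"
  proof induction
    case (Int a b)
    show ?case
    proof
      fix A assume "A \<in> a \<inter> b"
      then obtain F U G V where
        FG: "finite F" "F \<subseteq> topspace X" "openin X U" "A \<in> pr_basic F U" "pr_basic F U \<subseteq> a"
        "finite G" "G \<subseteq> topspace X" "openin X V" "A \<in> pr_basic G V" "pr_basic G V \<subseteq> b"
        using Int.IH by (metis IntE)
      have eq: "pr_basic (F \<union> G) (U \<inter> V) = pr_basic F U \<inter> pr_basic G V"
        by (auto simp: pr_basic_def)
      show "\<exists>F U. finite F \<and> F \<subseteq> topspace X \<and> openin X U \<and>
          A \<in> pr_basic F U \<and> pr_basic F U \<subseteq> a \<inter> b"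
      proof (intro exI conjI)
        show "finite (F \<union> G)" "F \<union> G \<subseteq> topspace X" using FG by simp_all
        show "openin X (U \<inter> V)" using FG by (simp add: openin_Int)
        show "A \<in> pr_basic (F \<union> G) (U \<inter> V)" unfolding eq using FG by blast
        show "pr_basic (F \<union> G) (U \<inter> V) \<subseteq> a \<inter> b" unfolding eq using FG by blast
      qed
    qed
  next
    case (UN K)
    show ?case
    proof
      fix A assume "A \<in> \<Union>K"
      then obtain k where k: "k \<in> K" "A \<in> k" by blast
      with UN.IH obtain F U where FU: "finite F" "F \<subseteq> topspace X" "openin X U"
          "A \<in> pr_basic F U" "pr_basic F U \<subseteq> k"
        by metis
      have "pr_basic F U \<subseteq> \<Union>K" using FU(5) k(1) by blast
      with FU show "\<exists>F U. finite F \<and> F \<subseteq> topspace X \<and> openin X U \<and>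
          A \<in> pr_basic F U \<and> pr_basic F U \<subseteq> \<Union>K"
        by metis
    qed
  next
    case Empty
    show ?case by simp
  next
    case (Basis s)
    then obtain F U where "s = pr_basic F U" "finite F" "F \<subseteq> topspace X" "openin X U" by blast
    then show ?case by (intro ballI exI[of _ F] exI[of _ U]) simp
  qed
next
  assume R: "?R W"
  have "\<exists>T. openin (pixley_roy X) T \<and> A \<in> T \<and> T \<subseteq> W" if A: "A \<in> W" for A
  proof -
    obtain F U where FU: "finite F" "F \<subseteq> topspace X" "openin X U"
        "A \<in> pr_basic F U" "pr_basic F U \<subseteq> W"
      using R[rule_format, OF A] by metis
    then have "openin (pixley_roy X) (pr_basic F U)"
      unfolding pixley_roy_def by (intro topology_generated_by_Basis) blast
    with FU show ?thesis by blast
  qed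
  then show "openin (pixley_roy X) W"
    using openin_subopen[of "pixley_roy X" W] by simp
qed

(* HOL cannot quantify over types inside a formula, so "there is a first-countable pseudocompact
   space Y" needs a fixed underlying type.  For X a topology on type 'a, 'a set set set is large
   enough for any Hausdorff Y in which PR(X) is dense: a point of Y is determined by the family of
   traces on PR(X) of its neighbourhoods, and the topology of Y can be transported along this
   injection.  The theorem states the equivalence with this carrier type, and additionally its
   "if" direction for Y on an arbitrary type. *)

end

theory Submission
  imports Defs "HOL-Library.Diagonal_Subsequence"
begin

text \<open>
  Write \<open>[A, U]\<close> for the basic open sets of \<open>PR(X)\<close>; all of them are clopen.

  Let \<open>X\<close> be a \<open>\<lambda>\<close>-set. By a diagonal argument every sequence of nonempty open subsets of \<open>PR(X)\<close>
  can be refined, along a subsequence, to a sequence of sets \<open>[A\<^sub>i, U\<^sub>i]\<close>, with \<open>U\<^sub>i\<close> the neighbourhood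
  of \<open>A\<^sub>i\<close> of some finite level, which decides every \<open>[D, U]\<close> of the same kind: it is eventually
  inside or eventually disjoint. Here the countable set \<open>\<Union>\<^sub>i A\<^sub>i\<close> being \<open>G\<^sub>\<delta>\<close> lets the \<open>U\<^sub>i\<close> leave
  every point outside it. Adjoin to \<open>PR(X)\<close> a maximal almost disjoint family of such deciding
  sequences that do not converge in \<open>PR(X)\<close>, the neighbourhoods of a new point being the tails.
  Decidedness makes the natural base clopen, and maximality gives every sequence of nonempty open
  sets a cluster point.

  Conversely let \<open>PR(X)\<close> be dense in a first-countable pseudocompact \<open>Y\<close>. Regularity of \<open>Y\<close> at the
  points \<open>{x}\<close> attaches a level to every \<open>x\<close>, so it suffices to separate a countable \<open>C\<close> by a \<open>G\<^sub>\<delta>\<close>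
  from the points of level \<open>n\<close> outside \<open>C\<close> in a cylinder \<open>B\<close> of level \<open>n\<close>. Enumerating \<open>C \<inter> B\<close> as
  \<open>c\<^sub>0, c\<^sub>1, \<dots>\<close>, a cluster point of the sets \<open>[{c\<^sub>0, \<dots>, c\<^sub>k}, B]\<close> and its countable
  neighbourhood base produce the desired \<open>G\<^sub>\<delta>\<close>.
\<close>

section \<open>Extensions by prescribed neighbourhood traces\<close>

text \<open>\<open>N z\<close> lists the traces on \<open>P\<close> of a neighbourhood base at the
  point \<open>z\<close> of the future extension, so the whole topology is described inside
  \<open>P\<close>. The condition \<open>nbhds_decide\<close> is what makes the resulting base
  clopen.\<close>

locale dense_extension =
  fixes P :: "'a topology" and Z :: "'b set" and N :: "'b \<Rightarrow> 'a set set" and e :: "'a \<Rightarrow> 'b"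
  assumes nbhd_open: "\<lbrakk>z \<in> Z; U \<in> N z\<rbrakk> \<Longrightarrow> openin P U"
    and nbhd_nonempty: "\<lbrakk>z \<in> Z; U \<in> N z\<rbrakk> \<Longrightarrow> U \<noteq> {}"
    and nbhds_countable: "z \<in> Z \<Longrightarrow> countable (N z)"
    and nbhds_nonempty: "z \<in> Z \<Longrightarrow> N z \<noteq> {}"
    and nbhds_directed: "\<lbrakk>z \<in> Z; U \<in> N z; V \<in> N z\<rbrakk> \<Longrightarrow> \<exists>W\<in>N z. W \<subseteq> U \<inter> V"
    and nbhds_decide: "\<lbrakk>z \<in> Z; U \<in> N z; y \<in> Z\<rbrakk> \<Longrightarrow> \<exists>V\<in>N y. V \<subseteq> U \<or> V \<inter> U = {}"
    and nbhds_separate: "\<lbrakk>z \<in> Z; y \<in> Z; z \<noteq> y\<rbrakk> \<Longrightarrow> \<exists>U\<in>N z. \<exists>V\<in>N y. U \<inter> V = {}"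
    and e_in: "a \<in> topspace P \<Longrightarrow> e a \<in> Z"
    and e_inj: "inj_on e (topspace P)"
    and e_mem: "\<lbrakk>a \<in> topspace P; U \<in> N (e a)\<rbrakk> \<Longrightarrow> a \<in> U"
    and e_base: "\<lbrakk>openin P W; a \<in> W\<rbrakk> \<Longrightarrow> \<exists>U\<in>N (e a). U \<subseteq> W"
begin

text \<open>For open \<open>W\<close> this is the largest open set of the extension whose trace on
  \<open>P\<close> is \<open>W\<close>.\<close>

definition star :: "'a set \<Rightarrow> 'b set"
  where "star W = {z \<in> Z. \<exists>U\<in>N z. U \<subseteq> W}"

definition ext :: "'b topology"
  where "ext = topology (\<lambda>Q. Q \<subseteq> Z \<and> (\<forall>z\<in>Q. \<exists>U\<in>N z. star U \<subseteq> Q))"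

lemma star_mono: "V \<subseteq> W \<Longrightarrow> star V \<subseteq> star W"
  unfolding star_def by blast

lemma mem_star: "\<lbrakk>z \<in> Z; U \<in> N z\<rbrakk> \<Longrightarrow> z \<in> star U"
  unfolding star_def by blast

lemma openin_ext: "openin ext Q \<longleftrightarrow> Q \<subseteq> Z \<and> (\<forall>z\<in>Q. \<exists>U\<in>N z. star U \<subseteq> Q)"
proof -
  have "istopology (\<lambda>Q. Q \<subseteq> Z \<and> (\<forall>z\<in>Q. \<exists>U\<in>N z. star U \<subseteq> Q))"
    unfolding istopology_def
  proof (intro conjI allI impI)
    fix S T
    assume S: "S \<subseteq> Z \<and> (\<forall>z\<in>S. \<exists>U\<in>N z. star U \<subseteq> S)"
      and T: "T \<subseteq> Z \<and> (\<forall>z\<in>T. \<exists>U\<in>N z. star U \<subseteq> T)"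
    show "S \<inter> T \<subseteq> Z" using S by blast
    show "\<forall>z\<in>S \<inter> T. \<exists>U\<in>N z. star U \<subseteq> S \<inter> T"
    proof
      fix z assume z: "z \<in> S \<inter> T"
      then obtain U V where "U \<in> N z" "star U \<subseteq> S" "V \<in> N z" "star V \<subseteq> T"
        using S T by blast
      moreover from this obtain W where "W \<in> N z" "W \<subseteq> U \<inter> V"
        using nbhds_directed[of z U V] S z by blast
      ultimately show "\<exists>U\<in>N z. star U \<subseteq> S \<inter> T"
        using star_mono[of W U] star_mono[of W V] by blast
    qed
  next
    fix K :: "'b set set"
    assume K: "\<forall>Q\<in>K. Q \<subseteq> Z \<and> (\<forall>z\<in>Q. \<exists>U\<in>N z. star U \<subseteq> Q)"
    show "\<Union>K \<subseteq> Z" using K by blast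
    show "\<forall>z\<in>\<Union>K. \<exists>U\<in>N z. star U \<subseteq> \<Union>K" using K by (meson Union_iff Union_upper subset_trans)
  qed
  then show ?thesis
    unfolding ext_def by (simp add: topology_inverse')
qed

lemma ext_nbhd:
  assumes "openin ext Q" "z \<in> Q" obtains U where "z \<in> Z" "U \<in> N z" "star U \<subseteq> Q"
proof -
  note Q = openin_ext[THEN iffD1, OF assms(1)]
  obtain U where "U \<in> N z" "star U \<subseteq> Q" using bspec[OF conjunct2[OF Q] assms(2)] by (elim bexE)
  then show thesis using that subsetD[OF conjunct1[OF Q] assms(2)] by simp
qed

lemma openin_star: "openin ext (star W)"
  unfolding openin_ext
proof (intro conjI ballI)
  show "star W \<subseteq> Z" by (auto simp: star_def)
  fix z assume "z \<in> star W"
  then obtain U where "U \<in> N z" "U \<subseteq> W" by (auto simp: star_def)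
  then show "\<exists>U\<in>N z. star U \<subseteq> star W" using star_mono by blast
qed

lemma topspace_ext: "topspace ext = Z"
proof
  show "topspace ext \<subseteq> Z" using openin_ext openin_topspace by blast
  have "openin ext Z"
    unfolding openin_ext using nbhds_nonempty by (auto simp: star_def)
  then show "Z \<subseteq> topspace ext" by (rule openin_subset)
qed

lemma star_disjoint:
  assumes "V \<inter> W = {}" shows "star V \<inter> star W = {}"
proof (rule ccontr)
  assume "star V \<inter> star W \<noteq> {}"
  then obtain z A B where z: "z \<in> Z" "A \<in> N z" "A \<subseteq> V" "B \<in> N z" "B \<subseteq> W"
    by (auto simp: star_def)
  then obtain C where "C \<in> N z" "C \<subseteq> A \<inter> B" using nbhds_directed by blast
  then show False using z nbhd_nonempty assms by blast
qed

text \<open>A point outside \<open>star U\<close> has no trace inside \<open>U\<close>, so by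
  \<open>nbhds_decide\<close> it has one disjoint from \<open>U\<close>, whose star misses
  \<open>star U\<close>.\<close>

lemma closedin_star:
  assumes "z \<in> Z" "U \<in> N z" shows "closedin ext (star U)"
  unfolding closedin_def
proof
  show "star U \<subseteq> topspace ext" by (auto simp: star_def topspace_ext)
  have "\<exists>V\<in>N y. star V \<subseteq> Z - star U" if "y \<in> Z - star U" for y
  proof -
    have y: "y \<in> Z" "\<not> (\<exists>V\<in>N y. V \<subseteq> U)" using that by (simp_all add: star_def)
    then obtain V where "V \<in> N y" "V \<inter> U = {}"
      using nbhds_decide[OF assms, of y] by blast
    moreover have "star V \<subseteq> Z" by (auto simp: star_def)
    ultimately show ?thesis using star_disjoint[of V U] by blast
  qed
  then show "openin ext (topspace ext - star U)"
    by (auto simp: openin_ext topspace_ext)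
qed

lemma first_countable_ext: "first_countable ext"
  unfolding first_countable_def topspace_ext
proof
  fix z assume z: "z \<in> Z"
  show "\<exists>\<B>. countable \<B> \<and> (\<forall>V\<in>\<B>. openin ext V) \<and>
      (\<forall>U. openin ext U \<and> z \<in> U \<longrightarrow> (\<exists>V\<in>\<B>. z \<in> V \<and> V \<subseteq> U))"
    using z nbhds_countable openin_star mem_star
    by (intro exI[of _ "star ` N z"]) (auto simp: openin_ext)
qed

lemma Hausdorff_ext: "Hausdorff_space ext"
  unfolding Hausdorff_space_def topspace_ext
proof (intro allI impI)
  fix z y assume "z \<in> Z \<and> y \<in> Z \<and> z \<noteq> y"
  moreover from this obtain U V where "U \<in> N z" "V \<in> N y" "U \<inter> V = {}"
    using nbhds_separate by blast
  ultimately show "\<exists>U V. openin ext U \<and> openin ext V \<and> z \<in> U \<and> y \<in> V \<and> disjnt U V"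
    using openin_star mem_star star_disjoint by (metis disjnt_def)
qed

lemma tychonoff_ext: "tychonoff_space ext"
proof -
  have "neighbourhood_base_of (\<lambda>Q. closedin ext Q \<and> openin ext Q) ext"
    unfolding neighbourhood_base_of
  proof (intro allI impI)
    fix W z assume Wz: "openin ext W \<and> z \<in> W"
    obtain U where U: "z \<in> Z" "U \<in> N z" "star U \<subseteq> W"
      by (rule ext_nbhd[OF conjunct1[OF Wz] conjunct2[OF Wz]])
    show "\<exists>S T. openin ext S \<and> (closedin ext T \<and> openin ext T) \<and> z \<in> S \<and> S \<subseteq> T \<and> T \<subseteq> W"
      using openin_star closedin_star[OF U(1,2)] mem_star[OF U(1,2)] U(3) by (metis order_refl)
  qed
  then show ?thesis
    unfolding tychonoff_space_def
    using zero_dimensional_imp_completely_regular_space Hausdorff_ext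
    by (simp add: dimension_le_0_neighbourhood_base_of_clopen)
qed

text \<open>Taking traces undoes \<open>star\<close> on open sets; continuity of \<open>e\<close>,
  its openness onto the image and its density all rest on this.\<close>

lemma e_mem_star:
  assumes "openin P W" "a \<in> topspace P" shows "e a \<in> star W \<longleftrightarrow> a \<in> W"
  using assms e_in e_mem e_base[OF assms(1)] unfolding star_def by blast

lemma continuous_e: "continuous_map P ext e"
  unfolding continuous_map_def
proof (intro conjI allI impI)
  show "e \<in> topspace P \<rightarrow> topspace ext" using e_in by (simp add: topspace_ext)
  fix Q assume Q: "openin ext Q"
  show "openin P {a \<in> topspace P. e a \<in> Q}"
  proof (subst openin_subopen, rule ballI)
    fix a assume a: "a \<in> {a \<in> topspace P. e a \<in> Q}"
    then obtain U where U: "U \<in> N (e a)" "star U \<subseteq> Q" using ext_nbhd[OF Q, of "e a"] by force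
    have "openin P U" "a \<in> U" using a U nbhd_open e_in e_mem by auto
    moreover have "U \<subseteq> {a \<in> topspace P. e a \<in> Q}"
      using U e_mem_star \<open>openin P U\<close> openin_subset by blast
    ultimately show "\<exists>T. openin P T \<and> a \<in> T \<and> T \<subseteq> {a \<in> topspace P. e a \<in> Q}" by blast
  qed
qed

lemma embedding_e: "embedding_map P ext e"
  unfolding embedding_map_def
proof (rule bijective_open_imp_homeomorphic_map)
  show "continuous_map P (subtopology ext (e ` topspace P)) e"
    using continuous_e by (simp add: continuous_map_in_subtopology)
  show "e ` topspace P = topspace (subtopology ext (e ` topspace P))"
    using e_in by (auto simp: topspace_ext)
  show "open_map P (subtopology ext (e ` topspace P)) e"
    unfolding open_map_def
  proof (intro allI impI)
    fix W assume W: "openin P W"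
    have "e ` W = star W \<inter> e ` topspace P"
      using e_mem_star[OF W] openin_subset[OF W] by blast
    then show "openin (subtopology ext (e ` topspace P)) (e ` W)"
      using openin_star by (auto simp: openin_subtopology)
  qed
qed (rule e_inj)

lemma ext_open_meets_image:
  assumes "openin ext Q" "Q \<noteq> {}" shows "\<exists>a\<in>topspace P. e a \<in> Q"
proof -
  obtain z U where z: "z \<in> Z" "U \<in> N z" "star U \<subseteq> Q"
    using ext_nbhd[OF assms(1)] assms(2) by (metis ex_in_conv)
  then obtain a where "a \<in> U" "openin P U" using nbhd_open nbhd_nonempty by blast
  then show ?thesis using z e_mem_star openin_subset by blast
qed

lemma embeds_densely_ext: "embeds_densely P ext"
proof -
  have "ext closure_of (e ` topspace P) = topspace ext"
    unfolding dense_intersects_open using ext_open_meets_image by blast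
  then show ?thesis unfolding embeds_densely_def using embedding_e by blast
qed

text \<open>If \<open>f\<close> is unbounded, the open sets where its absolute value exceeds
  \<open>k\<close> are nonempty, and by density so are their traces on \<open>P\<close>. Near a
  cluster point of these traces \<open>f\<close> stays below a fixed bound, which large
  \<open>k\<close> contradicts.\<close>

lemma pseudocompact_ext:
  assumes cluster: "\<And>V. (\<And>k::nat. openin P (V k) \<and> V k \<noteq> {}) \<Longrightarrow>
    \<exists>z\<in>Z. \<forall>U\<in>N z. \<exists>\<^sub>F k in sequentially. U \<inter> V k \<noteq> {}"
  shows "pseudocompact_space ext"
  unfolding pseudocompact_space_def
proof (intro conjI allI impI tychonoff_ext)
  fix f assume f: "continuous_map ext euclideanreal f"
  show "bounded (f ` topspace ext)"
  proof (rule ccontr)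
    assume unb: "\<not> bounded (f ` topspace ext)"
    define Q where "Q k = {z \<in> topspace ext. f z \<in> {x. \<bar>x\<bar> > real k}}" for k
    define V where "V k = {a \<in> topspace P. e a \<in> Q k}" for k
    have "open {x::real. \<bar>x\<bar> > r}" for r
      by (intro open_Collect_less continuous_intros)
    then have Q: "openin ext (Q k)" for k
      unfolding Q_def using f by (intro openin_continuous_map_preimage) auto
    have "V k \<noteq> {}" for k
    proof -
      have "Q k \<noteq> {}"
        using unb unfolding bounded_iff Q_def by (force simp: not_le)
      then show ?thesis using ext_open_meets_image[OF Q] by (auto simp: V_def)
    qed
    moreover have "openin P (V k)" for k
      unfolding V_def using Q by (rule openin_continuous_map_preimage[OF continuous_e])
    ultimately obtain z where z: "z \<in> Z" "\<And>U. U \<in> N z \<Longrightarrow> \<exists>\<^sub>F k in sequentially. U \<inter> V k \<noteq> {}"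
      using cluster[of V] by blast
    define R where "R = {y \<in> topspace ext. f y \<in> {x. \<bar>x\<bar> < \<bar>f z\<bar> + 1}}"
    have "open {x::real. \<bar>x\<bar> < r}" for r
      by (intro open_Collect_less continuous_intros)
    then have "openin ext R"
      unfolding R_def using f by (intro openin_continuous_map_preimage) auto
    moreover have "z \<in> R" using z by (simp add: R_def topspace_ext)
    ultimately obtain U where U: "U \<in> N z" "star U \<subseteq> R" by (rule ext_nbhd)
    have "\<exists>\<^sub>F k in sequentially. U \<inter> V k \<noteq> {} \<and> k \<ge> nat \<lceil>\<bar>f z\<bar> + 1\<rceil>"
      using z(2)[OF U(1)] eventually_ge_at_top by (rule frequently_eventually_frequently)
    then obtain k a where k: "a \<in> U" "a \<in> V k" "k \<ge> nat \<lceil>\<bar>f z\<bar> + 1\<rceil>"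
      by (auto dest!: frequently_ex)
    then have "e a \<in> star U"
      using e_mem_star[OF nbhd_open[OF z(1) U(1)]] by (simp add: V_def)
    then have "e a \<in> R" using U(2) by blast
    then have "\<bar>f (e a)\<bar> < \<bar>f z\<bar> + 1" by (simp add: R_def)
    moreover have "\<bar>f (e a)\<bar> > real k" using k(2) by (simp add: V_def Q_def)
    moreover have "real k \<ge> \<bar>f z\<bar> + 1" using k(3) by linarith
    ultimately show False by linarith
  qed
qed

end

section \<open>Diagonal subsequences and maximal families\<close>

text \<open>Successive subsequences each settle one index; the diagonal sequence is, up to finitely
  many terms, a subsequence of every one of them.\<close>

lemma diagonal_decision:
  fixes I :: "'i set" and Q :: "'i \<Rightarrow> nat \<Rightarrow> bool"
  assumes "countable I"
  shows "\<exists>r::nat \<Rightarrow> nat. strict_mono r \<and>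
    (\<forall>i\<in>I. (\<forall>\<^sub>F k in sequentially. Q i (r k)) \<or> (\<forall>\<^sub>F k in sequentially. \<not> Q i (r k)))"
proof -
  define S where "S n s \<longleftrightarrow> (\<forall>\<^sub>F k in sequentially. Q (from_nat_into I n) (s k)) \<or>
      (\<forall>\<^sub>F k in sequentially. \<not> Q (from_nat_into I n) (s k))" for n and s :: "nat \<Rightarrow> nat"
  have "\<exists>r. strict_mono r \<and> S n (s \<circ> r)" if "strict_mono s" for n and s :: "nat \<Rightarrow> nat"
  proof (cases "infinite {k. Q (from_nat_into I n) (s k)}")
    case True
    then obtain r :: "nat \<Rightarrow> nat" where "strict_mono r" "\<And>k. Q (from_nat_into I n) (s (r k))"
      using infinite_enumerate by force
    then show ?thesis by (auto simp: S_def)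
  next
    case False
    then have "\<forall>\<^sub>F k in sequentially. \<not> Q (from_nat_into I n) (s k)"
      by (simp add: cofinite_eq_sequentially[symmetric] eventually_cofinite)
    then show ?thesis unfolding S_def
      by (intro exI[of _ id]) (simp add: strict_mono_id)
  qed
  then interpret subseqs S by unfold_locales
  have tail: "S n (diagseq \<circ> (+) (Suc n))" for n
  proof (rule diagseq_holds)
    fix r s :: "nat \<Rightarrow> nat" and n assume "strict_mono r" "S n s"
    then show "S n (s \<circ> r)"
      unfolding S_def using eventually_subseq[of r] by force
  qed
  obtain d where d: "strict_mono d" "\<And>n. S n (d \<circ> (+) (Suc n))"
    using subseq_diagseq tail by blast
  \<comment> \<open>The shift by \<open>Suc n\<close> drops only finitely many terms, so the
    decision carries back to \<open>d\<close> itself.\<close>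
  have "S n d" for n
  proof -
    have "(\<lambda>k. d (Suc n + k)) = (\<lambda>k. d (k + Suc n))" by (simp add: add.commute)
    then show ?thesis
      using d(2)[of n] eventually_sequentially_seg[of "\<lambda>k. Q (from_nat_into I n) (d k)" "Suc n"]
        eventually_sequentially_seg[of "\<lambda>k. \<not> Q (from_nat_into I n) (d k)" "Suc n"]
      unfolding S_def o_def by metis
  qed
  then have "\<forall>i\<in>I. (\<forall>\<^sub>F k in sequentially. Q i (d k)) \<or> (\<forall>\<^sub>F k in sequentially. \<not> Q i (d k))"
    unfolding S_def using from_nat_into_surj[OF assms] by metis
  then show ?thesis using d(1) by blast
qed

text \<open>Zorn's lemma for the pairwise \<open>R\<close>-related subsets of \<open>F\<close>.
  Symmetry enters because adjoining \<open>t\<close> to \<open>M\<close> requires \<open>R\<close>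
  in both orders.\<close>

lemma maximal_pairwise:
  assumes sym: "\<And>x y. R x y \<Longrightarrow> R y x"
  shows "\<exists>M\<subseteq>F. pairwise R M \<and> (\<forall>t\<in>F. \<exists>s\<in>M. t = s \<or> \<not> R s t)"
proof -
  define A where "A = {M. M \<subseteq> F \<and> pairwise R M}"
  have "\<Union>C \<in> A" if "subset.chain A C" for C
  proof -
    have "C \<subseteq> A" "chain\<^sub>\<subseteq> C" using that by (simp_all add: subset_chain_def chain_subset_def)
    then have "pairwise R (\<Union>C)"
      by (intro pairwise_chain_Union) (auto simp: A_def)
    then show ?thesis using \<open>C \<subseteq> A\<close> by (auto simp: A_def)
  qed
  then obtain M where M: "M \<in> A" "\<And>X. X \<in> A \<Longrightarrow> M \<subseteq> X \<Longrightarrow> X = M"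
    using subset_Zorn'[of A] by metis
  have "\<exists>s\<in>M. t = s \<or> \<not> R s t" if "t \<in> F" for t
  proof (rule ccontr)
    assume *: "\<not> ?thesis"
    then have "insert t M \<in> A"
      using M(1) that sym by (simp add: A_def pairwise_insert)
    then have "insert t M = M" by (rule M(2)) (rule subset_insertI)
    with * show False by (metis insertI1)
  qed
  with M(1) show ?thesis by (auto simp: A_def)
qed

section \<open>Adjoining a maximal almost disjoint family\<close>

text \<open>\<open>L a\<close> is a countable base of clopen neighbourhoods at \<open>a\<close>. The
  assumption \<open>refine\<close> isolates the one property for which a \<lambda>-set will be
  required.\<close>

locale decisive_base =
  fixes P :: "'a topology" and L :: "'a \<Rightarrow> 'a set set"
  assumes Hausdorff: "Hausdorff_space P"
    and L_open: "\<lbrakk>a \<in> topspace P; R \<in> L a\<rbrakk> \<Longrightarrow> openin P R"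
    and L_closed: "\<lbrakk>a \<in> topspace P; R \<in> L a\<rbrakk> \<Longrightarrow> closedin P R"
    and L_mem: "\<lbrakk>a \<in> topspace P; R \<in> L a\<rbrakk> \<Longrightarrow> a \<in> R"
    and L_countable: "a \<in> topspace P \<Longrightarrow> countable (L a)"
    and L_base: "\<lbrakk>openin P W; a \<in> W\<rbrakk> \<Longrightarrow> \<exists>R\<in>L a. R \<subseteq> W"
    and refine: "(\<And>k::nat. openin P (V k) \<and> V k \<noteq> {}) \<Longrightarrow>
      \<exists>k r. strict_mono (k :: nat \<Rightarrow> nat) \<and>
        (\<forall>i. r i \<in> \<Union>(L ` topspace P) \<and> r i \<subseteq> V (k i)) \<and>
        (\<forall>R\<in>\<Union>(L ` topspace P). (\<forall>\<^sub>F i in sequentially. r i \<subseteq> R) \<or>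
                                     (\<forall>\<^sub>F i in sequentially. r i \<inter> R = {}))"
begin

definition \<B> :: "'a set set" where "\<B> = \<Union>(L ` topspace P)"

text \<open>The deciding sequences with no limit in \<open>P\<close>, stored as sets since only
  cofinite subfamilies matter. The last clause is local finiteness, which makes tails closed and
  separates the new point from the old ones.\<close>

definition free :: "'a set set \<Rightarrow> bool"
  where "free s \<longleftrightarrow> s \<subseteq> \<B> \<and> countable s \<and> infinite s \<and>
    (\<forall>R\<in>\<B>. finite {r\<in>s. \<not> r \<subseteq> R} \<or> finite {r\<in>s. r \<inter> R \<noteq> {}}) \<and>
    (\<forall>a\<in>topspace P. \<exists>R\<in>L a. finite {r\<in>s. r \<inter> R \<noteq> {}})"

lemma free_subset: "free s \<Longrightarrow> s \<subseteq> \<B>"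
  and free_infinite: "free s \<Longrightarrow> infinite s"
  and free_countable: "free s \<Longrightarrow> countable s"
  and free_far: "\<lbrakk>free s; a \<in> topspace P\<rbrakk> \<Longrightarrow> \<exists>R\<in>L a. finite {r\<in>s. r \<inter> R \<noteq> {}}"
  by (simp_all add: free_def)

text \<open>Disjointness is asked of the unions and not merely of the families, since unions of
  tails are the neighbourhood traces that must separate two new points.\<close>

definition almost_disjoint :: "'a set set \<Rightarrow> 'a set set \<Rightarrow> bool"
  where "almost_disjoint s t \<longleftrightarrow> (\<exists>K J. finite K \<and> finite J \<and> \<Union>(s - K) \<inter> \<Union>(t - J) = {})"

lemma almost_disjoint_commute: "almost_disjoint s t \<Longrightarrow> almost_disjoint t s"
  unfolding almost_disjoint_def by (metis Int_commute)

lemma \<B>_open: "R \<in> \<B> \<Longrightarrow> openin P R"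
  and \<B>_closed: "R \<in> \<B> \<Longrightarrow> closedin P R"
  and \<B>_nonempty: "R \<in> \<B> \<Longrightarrow> R \<noteq> {}"
  unfolding \<B>_def using L_open L_closed L_mem by blast+

lemma maximal_family:
  "\<exists>M. M \<subseteq> Collect free \<and> pairwise almost_disjoint M \<and>
    (\<forall>t. free t \<longrightarrow> (\<exists>s\<in>M. t = s \<or> \<not> almost_disjoint s t))"
  using maximal_pairwise[of almost_disjoint "Collect free"] almost_disjoint_commute by simp

definition M :: "'a set set set"
  where "M = (SOME M. M \<subseteq> Collect free \<and> pairwise almost_disjoint M \<and>
    (\<forall>t. free t \<longrightarrow> (\<exists>s\<in>M. t = s \<or> \<not> almost_disjoint s t)))"

lemma M_free: "s \<in> M \<Longrightarrow> free s"
  and M_disjoint: "\<lbrakk>s \<in> M; t \<in> M; s \<noteq> t\<rbrakk> \<Longrightarrow> almost_disjoint s t"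
  and M_maximal: "free t \<Longrightarrow> \<exists>s\<in>M. t = s \<or> \<not> almost_disjoint s t"
  using someI_ex[OF maximal_family, folded M_def] by (auto simp: pairwise_def)

text \<open>Members of \<open>M\<close> are infinite, so the singletons \<open>pt a\<close> never collide with them.\<close>

definition pt :: "'a \<Rightarrow> 'a set set" where "pt a = {{a}}"

definition Z :: "'a set set set" where "Z = pt ` topspace P \<union> M"

text \<open>\<open>K\<close> is kept inside \<open>s\<close> so that the tails of a countable
  \<open>s\<close> are indexed by its countably many finite subsets.\<close>

definition tails :: "'a set set \<Rightarrow> 'a set set"
  where "tails s = {\<Union>(s - K) | K. finite K \<and> K \<subseteq> s}"

text \<open>The double \<open>the_elem\<close> recovers \<open>a\<close> from
  \<open>pt a\<close>.\<close>

definition nbhds :: "'a set set \<Rightarrow> 'a set set"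
  where "nbhds z = (if z \<in> M then tails z else L (the_elem (the_elem z)))"

lemma pt_notin_M: "pt a \<notin> M"
  using M_free[of "pt a"] by (auto simp: free_def pt_def)

lemma nbhds_pt: "nbhds (pt a) = L a"
  using pt_notin_M[of a] by (simp add: nbhds_def) (simp add: pt_def)

lemma nbhds_M: "s \<in> M \<Longrightarrow> nbhds s = tails s"
  by (simp add: nbhds_def)

lemma tail_in_tails: assumes "finite K" shows "\<Union>(s - K) \<in> tails s"
  unfolding tails_def using assms by (intro CollectI exI[of _ "K \<inter> s"]) auto

lemma tail_nonempty: assumes "free s" "finite K" shows "\<Union>(s - K) \<noteq> {}"
proof -
  have "infinite (s - K)" using free_infinite[OF assms(1)] assms(2) by simp
  then obtain r where r: "r \<in> s - K" using infinite_imp_nonempty by blast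
  then have "r \<noteq> {}" using free_subset[OF assms(1)] \<B>_nonempty by blast
  then show ?thesis using r by blast
qed

lemma tail_open: assumes "free s" shows "openin P (\<Union>(s - K))"
proof (rule openin_Union)
  show "openin P r" if "r \<in> s - K" for r using that free_subset[OF assms] \<B>_open by blast
qed

text \<open>A point outside a tail has a neighbourhood meeting only finitely many of its clopen members.\<close>
lemma tail_closed: assumes "free s" shows "closedin P (\<Union>(s - K))"
proof -
  have "\<Union>(s - K) \<subseteq> topspace P" using tail_open[OF assms] openin_subset by blast
  moreover have "\<exists>T. openin P T \<and> a \<in> T \<and> T \<subseteq> topspace P - \<Union>(s - K)"
    if a: "a \<in> topspace P - \<Union>(s - K)" for a
  proof -
    obtain R where R: "R \<in> L a" "finite {r\<in>s. r \<inter> R \<noteq> {}}"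
      using free_far[OF assms, of a] a by blast
    let ?T = "R - \<Union>{r\<in>s - K. r \<inter> R \<noteq> {}}"
    have fin: "finite {r\<in>s - K. r \<inter> R \<noteq> {}}" using R(2) by (rule rev_finite_subset) auto
    have "openin P ?T"
      using free_subset[OF assms] a R L_open fin
      by (intro openin_diff closedin_Union) (auto intro: \<B>_closed)
    moreover have "a \<in> ?T" using L_mem a R by auto
    moreover have "?T \<subseteq> topspace P - \<Union>(s - K)"
      using openin_subset L_open a R by blast
    ultimately show ?thesis by blast
  qed
  ultimately show ?thesis
    unfolding closedin_def by (subst openin_subopen) blast
qed

lemma free_decides:
  assumes "free s" "R \<in> \<B>" shows "\<exists>V\<in>tails s. V \<subseteq> R \<or> V \<inter> R = {}"
proof -
  consider "finite {r\<in>s. \<not> r \<subseteq> R}" | "finite {r\<in>s. r \<inter> R \<noteq> {}}"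
    using assms by (simp add: free_def) blast
  then show ?thesis
  proof cases
    case 1 then show ?thesis by (intro bexI[OF _ tail_in_tails[OF 1]]) auto
  next
    case 2 then show ?thesis by (intro bexI[OF _ tail_in_tails[OF 2]]) auto
  qed
qed

lemma tails_directed:
  assumes "U \<in> tails s" "V \<in> tails s" shows "\<exists>W\<in>tails s. W \<subseteq> U \<inter> V"
proof -
  obtain K K' where "finite K" "U = \<Union>(s - K)" "finite K'" "V = \<Union>(s - K')"
    using assms by (auto simp: tails_def)
  then show ?thesis by (intro bexI[OF _ tail_in_tails[of "K \<union> K'"]]) auto
qed

text \<open>A common refinement of finitely many decisions. It handles the finitely many members of
  one family that may still meet late tails of another.\<close>

lemma free_decides_Union:
  assumes s: "free s" and "finite F" "F \<subseteq> \<B>"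
  shows "\<exists>V\<in>tails s. V \<subseteq> \<Union>F \<or> V \<inter> \<Union>F = {}"
  using assms(2,3)
proof (induction F)
  case empty
  then show ?case using tail_in_tails[of "{}" s] by auto
next
  case (insert R F)
  then obtain V where V: "V \<in> tails s" "V \<subseteq> \<Union>F \<or> V \<inter> \<Union>F = {}" by auto
  obtain V' where V': "V' \<in> tails s" "V' \<subseteq> R \<or> V' \<inter> R = {}"
    using free_decides[OF s, of R] insert.prems by auto
  obtain W where W: "W \<in> tails s" "W \<subseteq> V \<inter> V'" using tails_directed[OF V(1) V'(1)] by blast
  have "W \<subseteq> R \<union> \<Union>F \<or> W \<inter> (R \<union> \<Union>F) = {}" using V(2) V'(2) W(2) by blast
  then show ?case using W(1) by auto
qed

lemma tails_decide:
  assumes s: "s \<in> M" and t: "t \<in> M" and U: "U \<in> tails s"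
  shows "\<exists>V\<in>tails t. V \<subseteq> U \<or> V \<inter> U = {}"
proof (cases "s = t")
  case True
  then show ?thesis using U by blast
next
  case False
  obtain K where K: "finite K" "K \<subseteq> s" "U = \<Union>(s - K)" using U by (auto simp: tails_def)
  obtain K' J where J: "finite K'" "finite J" "\<Union>(s - K') \<inter> \<Union>(t - J) = {}"
    using M_disjoint[OF s t False] by (auto simp: almost_disjoint_def)
  \<comment> \<open>Only the members in \<open>s \<inter> K' - K\<close> can contribute to the part
    of \<open>U\<close> met by a late tail of \<open>t\<close>; they are finitely many elements of
    \<open>\<B>\<close>, so \<open>t\<close> decides their union.\<close>
  obtain V where V: "V \<in> tails t" "V \<subseteq> \<Union>(s \<inter> K' - K) \<or> V \<inter> \<Union>(s \<inter> K' - K) = {}"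
    using free_decides_Union[OF M_free[OF t], of "s \<inter> K' - K"] J(1) free_subset[OF M_free[OF s]]
    by blast
  obtain W where W: "W \<in> tails t" "W \<subseteq> V \<inter> \<Union>(t - J)"
    using tails_directed[OF V(1) tail_in_tails[OF J(2)]] by blast
  have "W \<inter> U = {}" if "V \<inter> \<Union>(s \<inter> K' - K) = {}"
    using that W(2) J(3) K(3) by blast
  moreover have "W \<subseteq> U" if "V \<subseteq> \<Union>(s \<inter> K' - K)" using that W(2) K(3) by blast
  ultimately have "W \<subseteq> U \<or> W \<inter> U = {}" using V(2) by argo
  then show ?thesis by (rule bexI[OF _ W(1)])
qed

lemma point_decides:
  assumes "a \<in> topspace P" "openin P U" "closedin P U"
  shows "\<exists>V\<in>L a. V \<subseteq> U \<or> V \<inter> U = {}"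
proof (cases "a \<in> U")
  case True
  then show ?thesis using L_base[OF assms(2)] by blast
next
  case False
  then obtain V where "V \<in> L a" "V \<subseteq> topspace P - U"
    using L_base[of "topspace P - U" a] assms(1,3) by (metis DiffI openin_diff openin_topspace)
  then show ?thesis by blast
qed

text \<open>Points of \<open>P\<close> decide every trace because all traces are clopen; new points
  decide basic sets by freeness and each other's tails by almost disjointness. An old point is
  separated from a new one by local finiteness.\<close>

sublocale dense_extension P Z nbhds pt
proof
  fix z U assume z: "z \<in> Z" and U: "U \<in> nbhds z"
  consider (point) a where "a \<in> topspace P" "z = pt a" | (family) "z \<in> M"
    using z by (auto simp: Z_def)
  note zcases = this
  show oU: "openin P U"
    using zcases U by cases (auto simp: nbhds_pt nbhds_M tails_def intro: L_open tail_open M_free)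
  show "U \<noteq> {}"
  proof (cases rule: zcases)
    case point then show ?thesis using U L_mem nbhds_pt by auto
  next
    case family
    then obtain K where "finite K" "U = \<Union>(z - K)" using U by (auto simp: nbhds_M tails_def)
    then show ?thesis using tail_nonempty[OF M_free[OF family]] by simp
  qed
  have cU: "closedin P U"
    using zcases U by cases (auto simp: nbhds_pt nbhds_M tails_def intro: L_closed tail_closed M_free)
  fix y assume "y \<in> Z"
  then consider (point) b where "b \<in> topspace P" "y = pt b" | (family) "y \<in> M"
    by (auto simp: Z_def)
  then show "\<exists>V\<in>nbhds y. V \<subseteq> U \<or> V \<inter> U = {}"
  proof cases
    case point
    then show ?thesis using point_decides oU cU by (simp add: nbhds_pt)
  next
    case y: family
    show ?thesis
    proof (cases rule: zcases)
      case point
      then have "U \<in> \<B>" using U by (auto simp: nbhds_pt \<B>_def)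
      then show ?thesis using free_decides M_free y by (simp add: nbhds_M)
    next
      case family
      then show ?thesis using tails_decide U y by (simp add: nbhds_M)
    qed
  qed
next
  fix z assume "z \<in> Z"
  then consider (point) a where "a \<in> topspace P" "z = pt a" | (family) "z \<in> M"
    by (auto simp: Z_def)
  note zcases = this
  show "countable (nbhds z)"
  proof (cases rule: zcases)
    case point then show ?thesis by (simp add: nbhds_pt L_countable)
  next
    case family
    have "countable {K. finite K \<and> K \<subseteq> z}"
      by (rule countable_Collect_finite_subset[OF free_countable[OF M_free[OF family]]])
    moreover have "nbhds z = (\<lambda>K. \<Union>(z - K)) ` {K. finite K \<and> K \<subseteq> z}"
      by (auto simp: nbhds_M[OF family] tails_def)
    ultimately show ?thesis by simp
  qed
  show "nbhds z \<noteq> {}"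
  proof (cases rule: zcases)
    case point then show ?thesis using L_base[of "topspace P" a] by (auto simp: nbhds_pt)
  next
    case family then show ?thesis using tail_in_tails[of "{}" z] by (auto simp: nbhds_M)
  qed
next
  fix z U V assume z: "z \<in> Z" "U \<in> nbhds z" "V \<in> nbhds z"
  then consider (point) a where "a \<in> topspace P" "z = pt a" | (family) "z \<in> M"
    by (auto simp: Z_def)
  then show "\<exists>W\<in>nbhds z. W \<subseteq> U \<inter> V"
  proof cases
    case point then show ?thesis using z L_open L_mem L_base[of "U \<inter> V" a] by (auto simp: nbhds_pt)
  next
    case family then show ?thesis using z tails_directed by (auto simp: nbhds_M)
  qed
next
  have pf: "\<exists>U\<in>nbhds (pt a). \<exists>V\<in>nbhds s. U \<inter> V = {}" if as: "a \<in> topspace P" "s \<in> M" for a s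
  proof -
    obtain R where R: "R \<in> L a" "finite {r\<in>s. r \<inter> R \<noteq> {}}"
      using free_far[OF M_free[OF as(2)] as(1)] by (elim bexE)
    have "R \<inter> \<Union>(s - {r\<in>s. r \<inter> R \<noteq> {}}) = {}" by auto
    moreover have "R \<in> nbhds (pt a)" using R by (simp add: nbhds_pt)
    moreover have "\<Union>(s - {r\<in>s. r \<inter> R \<noteq> {}}) \<in> nbhds s"
      using tail_in_tails[OF R(2)] as by (simp add: nbhds_M)
    ultimately show ?thesis by metis
  qed
  fix z y assume z: "z \<in> Z" and y: "y \<in> Z" and ne: "z \<noteq> y"
  show "\<exists>U\<in>nbhds z. \<exists>V\<in>nbhds y. U \<inter> V = {}"
  proof (cases "z \<in> M"; cases "y \<in> M")
    assume *: "z \<in> M" "y \<in> M"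
    then show ?thesis
      using M_disjoint[OF * ne] tail_in_tails[of _ z] tail_in_tails[of _ y] *
      unfolding almost_disjoint_def by (metis nbhds_M)
  next
    assume "z \<in> M" "y \<notin> M"
    then obtain b where b: "b \<in> topspace P" "y = pt b" using y by (auto simp: Z_def)
    from pf[OF b(1) \<open>z \<in> M\<close>] show ?thesis unfolding b(2) by (metis Int_commute)
  next
    assume "z \<notin> M" "y \<in> M"
    then obtain a where a: "a \<in> topspace P" "z = pt a" using z by (auto simp: Z_def)
    from pf[OF a(1) \<open>y \<in> M\<close>] show ?thesis unfolding a(2) .
  next
    assume "z \<notin> M" "y \<notin> M"
    then obtain a b where ab: "a \<in> topspace P" "z = pt a" "b \<in> topspace P" "y = pt b"
      using y z by (auto simp: Z_def)
    then have "a \<noteq> b" using ne by auto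
    then obtain U V where UV: "openin P U" "openin P V" "a \<in> U" "b \<in> V" "disjnt U V"
      using Hausdorff ab unfolding Hausdorff_space_def by metis
    then obtain R R' where "R \<in> L a" "R \<subseteq> U" "R' \<in> L b" "R' \<subseteq> V" using L_base by metis
    moreover from this have "R \<inter> R' = {}" using UV(5) by (auto simp: disjnt_def)
    ultimately show ?thesis unfolding ab nbhds_pt by metis
  qed
next
  show "inj_on pt (topspace P)" by (auto simp: inj_on_def pt_def)
  show "pt a \<in> Z" if "a \<in> topspace P" for a using that by (simp add: Z_def)
  show "a \<in> U" if "a \<in> topspace P" "U \<in> nbhds (pt a)" for a U
    using that L_mem by (simp add: nbhds_pt)
  show "\<exists>U\<in>nbhds (pt a). U \<subseteq> W" if "openin P W" "a \<in> W" for W a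
    using L_base[OF that] by (simp only: nbhds_pt)
qed

section \<open>Cluster points in the extension\<close>

text \<open>A basic set \<open>Q\<close> contains some point \<open>a\<close>, and the
  \<open>r i\<close> eventually miss a neighbourhood of \<open>a\<close>, so they cannot keep
  equalling \<open>Q\<close>.\<close>

lemma eventually_leaves:
  assumes r: "\<And>i::nat. r i \<in> \<B>"
    and far: "\<And>a. a \<in> topspace P \<Longrightarrow> \<exists>R\<in>L a. \<forall>\<^sub>F i in sequentially. r i \<inter> R = {}"
    and K: "finite K"
  shows "\<forall>\<^sub>F i in sequentially. r i \<notin> K"
proof -
  have "\<forall>\<^sub>F i in sequentially. r i \<noteq> Q" for Q
  proof (cases "Q \<in> \<B>")
    case True
    then obtain a where a: "a \<in> Q" "a \<in> topspace P"
      using \<B>_nonempty \<B>_open openin_subset by (metis ex_in_conv subsetD)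
    obtain R where R: "R \<in> L a" "\<forall>\<^sub>F i in sequentially. r i \<inter> R = {}"
      using far[OF a(2)] by (elim bexE)
    have "a \<in> R" using L_mem[OF a(2) R(1)] .
    from R(2) show ?thesis by eventually_elim (use a(1) \<open>a \<in> R\<close> in blast)
  next
    case False
    then have "r i \<noteq> Q" for i using r[of i] by auto
    then show ?thesis by simp
  qed
  then have "\<forall>\<^sub>F i in sequentially. \<forall>Q\<in>K. r i \<noteq> Q"
    using K by (simp add: eventually_ball_finite)
  then show ?thesis by eventually_elim auto
qed

lemma free_range:
  assumes r: "\<And>i::nat. r i \<in> \<B>"
    and dec: "\<And>R. R \<in> \<B> \<Longrightarrow>
      (\<forall>\<^sub>F i in sequentially. r i \<subseteq> R) \<or> (\<forall>\<^sub>F i in sequentially. r i \<inter> R = {})"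
    and far: "\<And>a. a \<in> topspace P \<Longrightarrow> \<exists>R\<in>L a. \<forall>\<^sub>F i in sequentially. r i \<inter> R = {}"
  shows "free (range r)"
proof -
  have fin: "finite {x \<in> range r. \<not> Q x}" if "\<forall>\<^sub>F i in sequentially. Q (r i)" for Q
  proof -
    have "finite {i. \<not> Q (r i)}"
      using that by (simp add: cofinite_eq_sequentially[symmetric] eventually_cofinite)
    moreover have "{x \<in> range r. \<not> Q x} = r ` {i. \<not> Q (r i)}" by auto
    ultimately show ?thesis by simp
  qed
  show ?thesis
    unfolding free_def
  proof (intro conjI ballI)
    show "range r \<subseteq> \<B>" using r by auto
    show "countable (range r)" by simp
    show "infinite (range r)"
      using eventually_leaves[of r "range r", OF r far] by auto
    show "finite {x \<in> range r. \<not> x \<subseteq> R} \<or> finite {x \<in> range r. x \<inter> R \<noteq> {}}" if "R \<in> \<B>" for R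
      using dec[OF that] fin[of "\<lambda>x. x \<subseteq> R"] fin[of "\<lambda>x. x \<inter> R = {}"] by (elim disjE) simp_all
    show "\<exists>R\<in>L a. finite {x \<in> range r. x \<inter> R \<noteq> {}}" if a: "a \<in> topspace P" for a
    proof -
      obtain R where R: "R \<in> L a" "\<forall>\<^sub>F i in sequentially. r i \<inter> R = {}"
        using far[OF a] by (elim bexE)
      show ?thesis using fin[of "\<lambda>x. x \<inter> R = {}", OF R(2)] R(1) by (rule bexI)
    qed
  qed
qed

text \<open>Refine to a deciding sequence. Either it enters every basic neighbourhood of some point
  of \<open>P\<close>, or its range is free and maximality of \<open>M\<close> supplies a member
  whose tails keep meeting it.\<close>

lemma cluster_point:
  assumes V: "\<And>k::nat. openin P (V k) \<and> V k \<noteq> {}"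
  shows "\<exists>z\<in>Z. \<forall>U\<in>nbhds z. \<exists>\<^sub>F k in sequentially. U \<inter> V k \<noteq> {}"
proof -
  obtain k :: "nat \<Rightarrow> nat" and r where k: "strict_mono k" and r: "\<And>i. r i \<in> \<B>" "\<And>i. r i \<subseteq> V (k i)"
    and dec: "\<And>R. R \<in> \<B> \<Longrightarrow> (\<forall>\<^sub>F i in sequentially. r i \<subseteq> R) \<or> (\<forall>\<^sub>F i in sequentially. r i \<inter> R = {})"
    using refine[of V, OF V, folded \<B>_def] by metis
  have meets: "\<exists>\<^sub>F k in sequentially. U \<inter> V k \<noteq> {}"
    if "\<exists>\<^sub>F i in sequentially. U \<inter> r i \<noteq> {}" for U
    unfolding frequently_sequentially
  proof
    fix n
    obtain i where "i \<ge> n" "U \<inter> r i \<noteq> {}"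
      using \<open>\<exists>\<^sub>F i in sequentially. U \<inter> r i \<noteq> {}\<close> unfolding frequently_sequentially by metis
    then have "k i \<ge> n" "U \<inter> V (k i) \<noteq> {}" using r(2)[of i] seq_suble[OF k, of i] by auto
    then show "\<exists>m\<ge>n. U \<inter> V m \<noteq> {}" by blast
  qed
  show ?thesis
  proof (cases "\<exists>a\<in>topspace P. \<forall>R\<in>L a. \<forall>\<^sub>F i in sequentially. r i \<subseteq> R")
    case True
    then obtain a where a: "a \<in> topspace P" "\<And>R. R \<in> L a \<Longrightarrow> \<forall>\<^sub>F i in sequentially. r i \<subseteq> R" by blast
    have "\<exists>\<^sub>F i in sequentially. R \<inter> r i \<noteq> {}" if "R \<in> L a" for R
    proof -
      have "\<forall>\<^sub>F i in sequentially. R \<inter> r i \<noteq> {}"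
        using a(2)[OF that]
      proof eventually_elim
        case (elim i)
        then show ?case using \<B>_nonempty[OF r(1)[of i]] by blast
      qed
      then show ?thesis by (rule eventually_frequently[OF sequentially_bot])
    qed
    then show ?thesis using a(1) meets by (intro bexI[of _ "pt a"]) (auto simp: nbhds_pt Z_def)
  next
    case False
    have far: "\<exists>R\<in>L a. \<forall>\<^sub>F i in sequentially. r i \<inter> R = {}" if a: "a \<in> topspace P" for a
    proof -
      have "\<exists>R\<in>L a. \<not> (\<forall>\<^sub>F i in sequentially. r i \<subseteq> R)" using False a by simp
      then obtain R where R: "R \<in> L a" "\<not> (\<forall>\<^sub>F i in sequentially. r i \<subseteq> R)" by (elim bexE)
      then have "R \<in> \<B>" using a by (auto simp: \<B>_def)
      from dec[OF this] R(2) have "\<forall>\<^sub>F i in sequentially. r i \<inter> R = {}" by simp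
      then show ?thesis using R(1) by (rule bexI)
    qed
    have leaves: "\<forall>\<^sub>F i in sequentially. r i \<notin> K" if "finite K" for K
      by (rule eventually_leaves[OF r(1) far that])
    have "free (range r)" by (rule free_range[OF r(1) dec far])
    then obtain s where s: "s \<in> M" "range r = s \<or> \<not> almost_disjoint s (range r)"
      using M_maximal by metis
    have "\<exists>\<^sub>F i in sequentially. \<Union>(s - K) \<inter> r i \<noteq> {}" if K: "finite K" for K
      unfolding frequently_sequentially
    proof
      fix n
      show "\<exists>i\<ge>n. \<Union>(s - K) \<inter> r i \<noteq> {}"
      proof (cases "range r = s")
        case True
        obtain i where i: "i \<ge> n" "r i \<notin> K"
          using leaves[OF K] unfolding eventually_sequentially by (meson nle_le)
        have "r i \<in> s" using True by blast
        with i have "\<Union>(s - K) \<inter> r i = r i" by blast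
        then show ?thesis using \<B>_nonempty[OF r(1)[of i]] i(1) by (intro exI[of _ i]) simp
      next
        case False
        \<comment> \<open>Discarding the values taken before \<open>n\<close> forces any
          intersecting term to have index at least \<open>n\<close>.\<close>
        have "finite (r ` {..<n})" by simp
        with False have "\<Union>(s - K) \<inter> \<Union>(range r - r ` {..<n}) \<noteq> {}"
          using s(2) K unfolding almost_disjoint_def by metis
        then obtain x where x: "x \<in> \<Union>(s - K)" "x \<in> \<Union>(range r - r ` {..<n})" by (metis IntE ex_in_conv)
        from x(2) obtain i where i: "x \<in> r i" "r i \<notin> r ` {..<n}" by auto
        then have "i \<ge> n" by (metis imageI lessThan_iff linorder_not_le)
        moreover have "\<Union>(s - K) \<inter> r i \<noteq> {}" using x(1) i(1) by (metis IntI empty_iff)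
        ultimately show ?thesis by (intro exI[of _ i]) simp
      qed
    qed
    then have "\<forall>U\<in>nbhds s. \<exists>\<^sub>F k in sequentially. U \<inter> V k \<noteq> {}"
      using meets by (auto simp: nbhds_M[OF s(1)] tails_def)
    moreover have "s \<in> Z" using s(1) by (simp add: Z_def)
    ultimately show ?thesis by (rule bexI)
  qed
qed

text \<open>Both \<open>pt a\<close> and the members of \<open>M\<close> are families of subsets of
  the type of \<open>P\<close>, which is where the carrier type \<open>'a set set\<close> comes
  from.\<close>

lemma first_countable_pseudocompact_extension:
  "\<exists>Y :: 'a set set topology. first_countable Y \<and> pseudocompact_space Y \<and> embeds_densely P Y"
  using first_countable_ext pseudocompact_ext[OF cluster_point] embeds_densely_ext by blast

end

section \<open>Finite levels of the Cantor space and Pixley--Roy hyperspaces\<close>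

text \<open>The union of the level-\<open>n\<close> cylinders around the points of \<open>A\<close>;
  for finite \<open>A\<close> these shrink into every open set containing \<open>A\<close>.\<close>

definition nb :: "nat \<Rightarrow> (nat \<Rightarrow> bool) set \<Rightarrow> (nat \<Rightarrow> bool) set"
  where "nb n A = {b. \<exists>a\<in>A. \<forall>i<n. b i = a i}"

abbreviation cyl :: "nat \<Rightarrow> (nat \<Rightarrow> bool) \<Rightarrow> (nat \<Rightarrow> bool) set"
  where "cyl n a \<equiv> nb n {a}"

lemma nb_superset: "A \<subseteq> nb n A"
  by (auto simp: nb_def)

lemma nb_antimono: "m \<le> n \<Longrightarrow> nb n A \<subseteq> nb m A"
  by (force simp: nb_def)

lemma nb_UN: "nb n A = (\<Union>a\<in>A. cyl n a)"
  by (auto simp: nb_def)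

lemma nb_nb: "A \<subseteq> nb n B \<Longrightarrow> nb n A \<subseteq> nb n B"
proof
  fix b assume A: "A \<subseteq> nb n B" and "b \<in> nb n A"
  then obtain a where a: "a \<in> A" "\<forall>i<n. b i = a i" by (auto simp: nb_def)
  then obtain c where c: "c \<in> B" "\<forall>i<n. a i = c i" using A by (auto simp: nb_def)
  then have "\<forall>i<n. b i = c i" using a by simp
  then show "b \<in> nb n B" using c(1) unfolding nb_def by (intro CollectI bexI)
qed

lemma cyl_eq: "b \<in> cyl n a \<Longrightarrow> cyl n b = cyl n a"
  by (auto simp: nb_def)

lemma openin_coordinate: "openin cantor_space {b. P (b i)}"
proof -
  have "openin cantor_space {b \<in> topspace cantor_space. b i \<in> Collect P}"
    unfolding cantor_space_def
    by (intro openin_continuous_map_preimage[where Y = "discrete_topology UNIV"]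
        continuous_map_product_projection) auto
  then show ?thesis by simp
qed

lemma openin_cyl: "openin cantor_space (cyl n a)"
proof -
  have "openin cantor_space (topspace cantor_space \<inter> \<Inter>((\<lambda>i. {b. b i = a i}) ` {..<n}))"
    using openin_topspace[of cantor_space] by (intro openin_Int_Inter) (auto intro: openin_coordinate)
  moreover have "topspace cantor_space \<inter> \<Inter>((\<lambda>i. {b. b i = a i}) ` {..<n}) = cyl n a"
    by (auto simp: nb_def)
  ultimately show ?thesis by simp
qed

lemma openin_nb: "openin cantor_space (nb n A)"
  by (subst nb_UN) (auto intro: openin_cyl)

lemma closedin_nb: "closedin cantor_space (nb n A)"
proof -
  \<comment> \<open>Agreement below \<open>n\<close> is an equivalence relation, so the complement
    is again a union of cylinders of level \<open>n\<close>.\<close>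
  have "UNIV - nb n A = nb n (- nb n A)"
  proof
    show "UNIV - nb n A \<subseteq> nb n (- nb n A)" using nb_superset[of "- nb n A" n] by (simp add: Compl_eq_Diff_UNIV)
    show "nb n (- nb n A) \<subseteq> UNIV - nb n A"
    proof
      fix b assume "b \<in> nb n (- nb n A)"
      then obtain c where c: "c \<notin> nb n A" "\<forall>i<n. b i = c i" by (auto simp only: nb_def Compl_iff)
      have False if bA: "b \<in> nb n A"
      proof -
        obtain a where a: "a \<in> A" "\<forall>i<n. b i = a i" using bA by (auto simp: nb_def)
        then have "\<forall>i<n. c i = a i" using c(2) by simp
        then have "c \<in> nb n A" using a(1) unfolding nb_def by (intro CollectI bexI)
        with c(1) show False ..
      qed
      then show "b \<in> UNIV - nb n A" by blast
    qed
  qed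
  then show ?thesis unfolding closedin_def using openin_nb by simp
qed

lemma cyl_base:
  assumes "openin cantor_space U" "a \<in> U" shows "\<exists>n. cyl n a \<subseteq> U"
proof -
  obtain V where V: "finite {i. V i \<noteq> UNIV}" "a \<in> Pi\<^sub>E UNIV V" "Pi\<^sub>E UNIV V \<subseteq> U"
    using assms unfolding cantor_space_def openin_product_topology_alt by auto
  obtain n where n: "\<And>i. V i \<noteq> UNIV \<Longrightarrow> i < n"
    using V(1) finite_nat_set_iff_bounded by auto
  have "b \<in> U" if "b \<in> cyl n a" for b
  proof -
    have "b i \<in> V i" for i
      using n[of i] that V(2) by (cases "V i = UNIV") (auto simp: nb_def PiE_iff)
    then show ?thesis using V(3) by auto
  qed
  then show ?thesis by blast
qed

lemma nb_base:
  assumes "finite A" "openin cantor_space U" "A \<subseteq> U"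
  shows "\<forall>\<^sub>F n in sequentially. nb n A \<subseteq> U"
proof -
  have "\<forall>\<^sub>F n in sequentially. cyl n a \<subseteq> U" if a: "a \<in> A" for a
  proof -
    obtain m where m: "cyl m a \<subseteq> U" using cyl_base[OF assms(2) subsetD[OF assms(3) a]] by blast
    show ?thesis
      using eventually_ge_at_top[of m]
      by eventually_elim (rule subset_trans[OF nb_antimono m])
  qed
  then have "\<forall>\<^sub>F n in sequentially. \<forall>a\<in>A. cyl n a \<subseteq> U"
    by (simp add: eventually_ball_finite assms(1))
  then show ?thesis by eventually_elim (simp add: nb_UN[of _ A] UN_subset_iff)
qed

text \<open>\<open>nb n A\<close> depends only on the initial segments of length \<open>n\<close> of the members of \<open>A\<close>.\<close>
lemma countable_nbs: "countable {nb n A | n A. finite A}"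
proof -
  \<comment> \<open>\<open>w\<close> pads a word with \<open>False\<close>; the padding is invisible
    because \<open>nb n\<close> reads only coordinates below \<open>n\<close>.\<close>
  define w :: "bool list \<Rightarrow> nat \<Rightarrow> bool" where "w l = (\<lambda>i. if i < length l then l ! i else False)" for l
  have *: "nb n A = nb n (w ` (\<lambda>a. map a [0..<n]) ` A)" for n A
    unfolding nb_def by (auto simp: w_def)
  have "{nb n A | n A. finite A} \<subseteq> (\<lambda>(n, W). nb n (w ` W)) ` (UNIV \<times> {W. finite W})"
  proof
    fix B assume "B \<in> {nb n A | n A. finite A}"
    then obtain n A where nA: "finite A" "B = nb n A" by (elim CollectE exE conjE)
    then have "B = (\<lambda>(n, W). nb n (w ` W)) (n, (\<lambda>a. map a [0..<n]) ` A)"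
      using *[of n A] by simp
    moreover have "(n, (\<lambda>a. map a [0..<n]) ` A) \<in> UNIV \<times> {W. finite W}" using nA(1) by simp
    ultimately show "B \<in> (\<lambda>(n, W). nb n (w ` W)) ` (UNIV \<times> {W. finite W})"
      by (rule image_eqI)
  qed
  moreover have "countable ((\<lambda>(n, W). nb n (w ` W)) ` (UNIV \<times> {W. finite W}))"
    using countable_Collect_finite by (intro countable_image countable_SIGMA) auto
  ultimately show ?thesis by (rule countable_subset)
qed

section \<open>A clopen base of the Pixley-Roy hyperspace\<close>

abbreviation pr :: "(nat \<Rightarrow> bool) set \<Rightarrow> (nat \<Rightarrow> bool) set topology"
  where "pr X \<equiv> pixley_roy (subtopology cantor_space X)"

lemma topspace_pr: "topspace (pr X) = {A. finite A \<and> A \<subseteq> X}"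
  by (simp add: topspace_pixley_roy)

lemma openin_nb_Int: "openin (subtopology cantor_space X) (X \<inter> nb n A)"
  using openin_nb by (auto simp: openin_subtopology)

lemma openin_pr_basic:
  assumes "finite F" "F \<subseteq> X" "openin (subtopology cantor_space X) U"
  shows "openin (pr X) (pr_basic F U)"
  unfolding openin_pixley_roy
proof
  fix A assume "A \<in> pr_basic F U"
  then have "finite F \<and> F \<subseteq> topspace (subtopology cantor_space X) \<and>
      openin (subtopology cantor_space X) U \<and> A \<in> pr_basic F U \<and> pr_basic F U \<subseteq> pr_basic F U"
    using assms by simp
  then show "\<exists>F' U'. finite F' \<and> F' \<subseteq> topspace (subtopology cantor_space X) \<and>
      openin (subtopology cantor_space X) U' \<and> A \<in> pr_basic F' U' \<and> pr_basic F' U' \<subseteq> pr_basic F U"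
    by (intro exI)
qed

lemma pr_basic_mono: "\<lbrakk>F \<subseteq> A; V \<subseteq> U\<rbrakk> \<Longrightarrow> pr_basic A V \<subseteq> pr_basic F U"
  unfolding pr_basic_def by (simp add: Collect_mono_iff) (meson subset_trans)

lemma openin_self: "openin (subtopology cantor_space X) X"
  using openin_topspace[of "subtopology cantor_space X"] by simp

lemma nb_base_subtopology:
  assumes "finite A" "openin (subtopology cantor_space X) U" "A \<subseteq> U"
  shows "\<forall>\<^sub>F n in sequentially. X \<inter> nb n A \<subseteq> U"
proof -
  obtain V where V: "openin cantor_space V" "U = V \<inter> X" using assms(2) by (auto simp: openin_subtopology)
  then have "\<forall>\<^sub>F n in sequentially. nb n A \<subseteq> V" using nb_base assms by blast
  then show ?thesis by eventually_elim (use V in blast)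
qed

text \<open>Raising the lower set \<open>F\<close> to \<open>A\<close> only shrinks a basic set, so
  the lower set can be \<open>A\<close> itself and only the level of the upper set varies.\<close>

lemma pr_base:
  assumes "openin (pr X) W" "A \<in> W"
  shows "\<forall>\<^sub>F n in sequentially. pr_basic A (X \<inter> nb n A) \<subseteq> W"
proof -
  obtain F U where FU: "openin (subtopology cantor_space X) U" "A \<in> pr_basic F U" "pr_basic F U \<subseteq> W"
    using assms unfolding openin_pixley_roy by metis
  have A: "finite A" "F \<subseteq> A" "A \<subseteq> U" using FU(2) by (simp_all add: pr_basic_def)
  have "\<forall>\<^sub>F n in sequentially. X \<inter> nb n A \<subseteq> U"
    by (rule nb_base_subtopology[OF A(1) FU(1) A(3)])
  then show ?thesis
  proof eventually_elim
    case (elim n)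
    then have "pr_basic A (X \<inter> nb n A) \<subseteq> pr_basic F U" by (rule pr_basic_mono[OF A(2)])
    then show ?case using FU(3) by (rule subset_trans)
  qed
qed

lemma openin_remove_point:
  assumes "openin (subtopology cantor_space X) U"
  shows "openin (subtopology cantor_space X) (U - {x})"
proof (cases "x \<in> X")
  case True
  have "Hausdorff_space cantor_space"
    unfolding cantor_space_def by (simp add: Hausdorff_space_product_topology)
  then have "closedin (subtopology cantor_space X) {x}"
    using True by (intro closedin_Hausdorff_singleton Hausdorff_space_subtopology) auto
  then show ?thesis using assms by (rule openin_diff[rotated])
next
  case False
  then have "U - {x} = U" using openin_subset[OF assms] by auto
  then show ?thesis using assms by simp
qed

text \<open>A finite set \<open>A\<close> outside either omits some \<open>x\<close> in
  \<open>F\<close> or contains some \<open>x\<close> outside \<open>U\<close>. The first persists on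
  \<open>pr_basic A (X - {x})\<close>, the second on \<open>pr_basic A X\<close>.\<close>

lemma closedin_pr_basic:
  assumes F: "finite F" "F \<subseteq> X" and U: "openin (subtopology cantor_space X) U"
  shows "closedin (pr X) (pr_basic F U)"
  unfolding closedin_def
proof
  show "pr_basic F U \<subseteq> topspace (pr X)"
    using openin_pr_basic[OF assms] by (rule openin_subset)
  have "\<exists>T. openin (pr X) T \<and> A \<in> T \<and> T \<subseteq> topspace (pr X) - pr_basic F U"
    if A: "A \<in> topspace (pr X) - pr_basic F U" for A
  proof -
    have fA: "finite A" "A \<subseteq> X" using A by (auto simp: topspace_pr)
    consider x where "x \<in> F" "x \<notin> A" | x where "x \<in> A" "x \<notin> U"
      using A by (auto simp: topspace_pr pr_basic_def)
    then show ?thesis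
    proof cases
      case 1
      have op: "openin (pr X) (pr_basic A (X - {x}))"
        by (rule openin_pr_basic[OF fA openin_remove_point[OF openin_self]])
      moreover have "A \<in> pr_basic A (X - {x})" using 1 fA by (auto simp: pr_basic_def)
      moreover have "pr_basic A (X - {x}) \<inter> pr_basic F U = {}"
        using 1 unfolding pr_basic_def by blast
      ultimately show ?thesis using openin_subset[OF op] by (metis Diff_triv Diff_mono order_refl)
    next
      case 2
      have op: "openin (pr X) (pr_basic A X)"
        by (rule openin_pr_basic[OF fA openin_self])
      moreover have "A \<in> pr_basic A X" using fA by (auto simp: pr_basic_def)
      moreover have "pr_basic A X \<inter> pr_basic F U = {}"
        using 2 unfolding pr_basic_def by blast
      ultimately show ?thesis using openin_subset[OF op] by (metis Diff_triv Diff_mono order_refl)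
    qed
  qed
  then show "openin (pr X) (topspace (pr X) - pr_basic F U)"
    by (subst openin_subopen) blast
qed

lemma Hausdorff_pr: "Hausdorff_space (pr X)"
proof -
  have *: "\<exists>U V. openin (pr X) U \<and> openin (pr X) V \<and> A \<in> U \<and> B \<in> V \<and> disjnt U V"
    if "A \<in> topspace (pr X)" "B \<in> topspace (pr X)" "\<not> A \<subseteq> B" for A B
  proof -
    have W: "openin (pr X) (pr_basic A X)" "closedin (pr X) (pr_basic A X)"
      using that by (auto intro!: openin_pr_basic closedin_pr_basic openin_self simp: topspace_pr)
    have "openin (pr X) (topspace (pr X) - pr_basic A X)" using W(2) by blast
    then show ?thesis using W(1) that
      by (intro exI[of _ "pr_basic A X"] exI[of _ "topspace (pr X) - pr_basic A X"])
        (auto simp: disjnt_def topspace_pr pr_basic_def)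
  qed
  show ?thesis
    unfolding Hausdorff_space_def
    using * by (metis disjnt_sym subset_antisym)
qed

section \<open>Deciding refinements over a \<lambda>-set\<close>

text \<open>The diagonal argument settles only the centres \<open>A i\<close>; the levels
  \<open>m i\<close> are then taken so large that all members of \<open>r i\<close> follow
  them.\<close>

lemma pr_refine:
  assumes X: "lambda_set X" and V: "\<And>k::nat. openin (pr X) (V k) \<and> V k \<noteq> {}"
  shows "\<exists>k r. strict_mono (k :: nat \<Rightarrow> nat) \<and>
    (\<forall>i. (\<exists>A n. finite A \<and> A \<subseteq> X \<and> r i = pr_basic A (X \<inter> nb n A)) \<and> r i \<subseteq> V (k i)) \<and>
    (\<forall>D n. finite D \<longrightarrow> D \<subseteq> X \<longrightarrow>
      (\<forall>\<^sub>F i in sequentially. r i \<subseteq> pr_basic D (X \<inter> nb n D)) \<or>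
      (\<forall>\<^sub>F i in sequentially. r i \<inter> pr_basic D (X \<inter> nb n D) = {}))"
proof -
  have "\<forall>k. \<exists>A. A \<in> V k" using V by (simp add: ex_in_conv)
  then obtain A0 where A0: "\<And>k. A0 k \<in> V k" by metis
  define S where "S = (\<Union>k. A0 k)"
  have A0_sub: "finite (A0 k)" "A0 k \<subseteq> X" for k
    using A0[of k] V[of k] openin_subset[of "pr X" "V k"] by (auto simp: topspace_pr)
  have S: "S \<subseteq> X" "countable S" unfolding S_def using A0_sub by (auto intro: countable_finite)
  \<comment> \<open>Two countable kinds of questions: containment in each finite-level set and
    membership of each point of \<open>S\<close>. Points outside \<open>S\<close> are left to the
    G-delta property of \<open>S\<close>, where the \<lambda>-set hypothesis enters.\<close>
  let ?Q = "\<lambda>p k. case p of Inl B \<Rightarrow> A0 k \<subseteq> B | Inr x \<Rightarrow> x \<in> A0 k"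
  let ?I = "Inl ` {nb n A | n A. finite A} \<union> Inr ` S"
  have "countable ?I" using S countable_nbs by simp
  from diagonal_decision[OF this, of ?Q] obtain k :: "nat \<Rightarrow> nat" where k: "strict_mono k"
    and dec: "\<forall>p\<in>?I. (\<forall>\<^sub>F i in sequentially. ?Q p (k i)) \<or> (\<forall>\<^sub>F i in sequentially. \<not> ?Q p (k i))"
    by blast
  define A where "A i = A0 (k i)" for i
  have dec_nb: "(\<forall>\<^sub>F i in sequentially. A i \<subseteq> nb n D) \<or> (\<forall>\<^sub>F i in sequentially. \<not> A i \<subseteq> nb n D)"
    if "finite D" for n D
    using dec that unfolding A_def by (auto dest!: bspec[of _ _ "Inl (nb n D)"])
  have dec_mem: "(\<forall>\<^sub>F i in sequentially. x \<in> A i) \<or> (\<forall>\<^sub>F i in sequentially. x \<notin> A i)"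
    if "x \<in> S" for x
    using dec that unfolding A_def by (auto dest!: bspec[of _ _ "Inr x"])
  have A: "finite (A i)" "A i \<subseteq> S" "A i \<subseteq> X" for i
    using A0_sub S unfolding A_def S_def by auto
  obtain G where G: "\<And>n. openin (subtopology cantor_space X) (G n)"
      "\<And>n. G (Suc n) \<subseteq> G n" "\<Inter>(range G) = S"
    using X S unfolding lambda_set_def gdelta_in_descending by metis
  \<comment> \<open>The level must keep the neighbourhood inside \<open>G i\<close>, against points
    outside \<open>S\<close>, and away from those of the first \<open>i + 1\<close> enumerated
    points of \<open>S\<close> that are not in \<open>A i\<close>; \<open>m \<ge> i\<close>
    eventually makes it finer than any given level.\<close>
  have "\<exists>m\<ge>i. pr_basic (A i) (X \<inter> nb m (A i)) \<subseteq> V (k i) \<and> X \<inter> nb m (A i) \<subseteq> G i \<and>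
      (\<forall>j\<le>i. from_nat_into S j \<notin> A i \<longrightarrow> from_nat_into S j \<notin> X \<inter> nb m (A i))" for i
  proof -
    have "\<forall>\<^sub>F m in sequentially. pr_basic (A i) (X \<inter> nb m (A i)) \<subseteq> V (k i)"
      using V A0[of "k i"] by (intro pr_base) (auto simp: A_def)
    moreover have "\<forall>\<^sub>F m in sequentially. X \<inter> nb m (A i) \<subseteq> G i"
    proof (rule nb_base_subtopology[OF A(1) G(1)])
      show "A i \<subseteq> G i" using A(2)[of i] G(3) by (metis INF_lower UNIV_I subset_trans)
    qed
    moreover have "\<forall>\<^sub>F m in sequentially. \<forall>j\<in>{..i}. from_nat_into S j \<notin> A i \<longrightarrow> from_nat_into S j \<notin> X \<inter> nb m (A i)"
    proof (intro eventually_ball_finite ballI)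
      fix j
      show "\<forall>\<^sub>F m in sequentially. from_nat_into S j \<notin> A i \<longrightarrow> from_nat_into S j \<notin> X \<inter> nb m (A i)"
      proof (cases "from_nat_into S j \<in> A i")
        case False
        have "\<forall>\<^sub>F m in sequentially. X \<inter> nb m (A i) \<subseteq> X - {from_nat_into S j}"
          by (rule nb_base_subtopology[OF A(1) openin_remove_point[OF openin_self]])
            (use A(3)[of i] False in blast)
        then show ?thesis by eventually_elim blast
      qed simp
    qed simp
    ultimately have "\<forall>\<^sub>F m in sequentially. m \<ge> i \<and> pr_basic (A i) (X \<inter> nb m (A i)) \<subseteq> V (k i) \<and>
       X \<inter> nb m (A i) \<subseteq> G i \<and>
      (\<forall>j\<in>{..i}. from_nat_into S j \<notin> A i \<longrightarrow> from_nat_into S j \<notin> X \<inter> nb m (A i))"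
      using eventually_ge_at_top by (intro eventually_conj)
    from eventually_happens'[OF sequentially_bot this] show ?thesis
      by (simp only: Ball_def atMost_iff)
  qed
  then obtain m where m: "\<And>i. m i \<ge> i"
      "\<And>i. pr_basic (A i) (X \<inter> nb (m i) (A i)) \<subseteq> V (k i)"
      "\<And>i. X \<inter> nb (m i) (A i) \<subseteq> G i"
      "\<And>i j. j \<le> i \<Longrightarrow> from_nat_into S j \<notin> A i \<Longrightarrow> from_nat_into S j \<notin> X \<inter> nb (m i) (A i)"
    by metis
  define r where "r i = pr_basic (A i) (X \<inter> nb (m i) (A i))" for i
  have "(\<forall>\<^sub>F i in sequentially. r i \<subseteq> pr_basic D (X \<inter> nb n D)) \<or>
      (\<forall>\<^sub>F i in sequentially. r i \<inter> pr_basic D (X \<inter> nb n D) = {})"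
    if D: "finite D" "D \<subseteq> X" for D n
  proof -
    have avoid: "\<forall>\<^sub>F i in sequentially. r i \<inter> pr_basic D (X \<inter> nb n D) = {}"
      if "d \<in> D" "\<forall>\<^sub>F i in sequentially. d \<notin> X \<inter> nb (m i) (A i)" for d
      using that(2) by eventually_elim (use that(1) in \<open>auto simp: r_def pr_basic_def\<close>)
    \<comment> \<open>Apart from the upper bound, a point \<open>d\<close> of \<open>D\<close> can
      lie outside \<open>S\<close>, be eventually absent from the \<open>A i\<close>, or be
      eventually present. In the first two cases no member of \<open>r i\<close> contains
      \<open>d\<close> for large \<open>i\<close>.\<close>
    consider (outside) "\<forall>\<^sub>F i in sequentially. \<not> A i \<subseteq> nb n D"
      | (escape) d where "d \<in> D" "d \<notin> S"
      | (drop) d where "d \<in> D" "d \<in> S" "\<forall>\<^sub>F i in sequentially. d \<notin> A i"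
      | (inside) "\<forall>\<^sub>F i in sequentially. A i \<subseteq> nb n D" "\<forall>d\<in>D. \<forall>\<^sub>F i in sequentially. d \<in> A i"
      using dec_nb[OF D(1), of n] dec_mem by blast
    then show ?thesis
    proof cases
      case outside
      then have "\<forall>\<^sub>F i in sequentially. r i \<inter> pr_basic D (X \<inter> nb n D) = {}"
        by eventually_elim (auto simp: r_def pr_basic_def)
      then show ?thesis ..
    next
      case escape
      then obtain j where j: "d \<notin> G j" using G(3) by blast
      have "\<forall>\<^sub>F i in sequentially. d \<notin> X \<inter> nb (m i) (A i)"
        using eventually_ge_at_top[of j]
      proof eventually_elim
        case (elim i)
        then have "G i \<subseteq> G j" using G(2) lift_Suc_antimono_le by blast
        then show ?case using m(3) j by blast
      qed
      with avoid escape show ?thesis by blast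
    next
      case drop
      then obtain j where "d = from_nat_into S j" using S from_nat_into_surj by metis
      then have "\<forall>\<^sub>F i in sequentially. d \<notin> X \<inter> nb (m i) (A i)"
        using eventually_conj[OF drop(3) eventually_ge_at_top[of j]]
        by (elim eventually_mono) (use m(4) in blast)
      with avoid drop show ?thesis by blast
    next
      case inside
      have "\<forall>\<^sub>F i in sequentially. \<forall>d\<in>D. d \<in> A i"
        using inside(2) D(1) by (simp add: eventually_ball_finite)
      with inside(1) eventually_ge_at_top[of n]
      have "\<forall>\<^sub>F i in sequentially. r i \<subseteq> pr_basic D (X \<inter> nb n D)"
      proof eventually_elim
        case (elim i)
        have "nb (m i) (A i) \<subseteq> nb n (A i)" using elim m(1)[of i] by (intro nb_antimono) simp
        also have "\<dots> \<subseteq> nb n D" using elim nb_nb by blast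
        finally show ?case using elim by (auto simp: r_def pr_basic_def)
      qed
      then show ?thesis ..
    qed
  qed
  moreover have "\<exists>B n. finite B \<and> B \<subseteq> X \<and> r i = pr_basic B (X \<inter> nb n B)" for i
    using A(1)[of i] A(3)[of i] r_def by blast
  moreover have "r i \<subseteq> V (k i)" for i using m(2) by (simp add: r_def)
  ultimately show ?thesis
    using k by (intro exI[of _ k] exI[of _ r] conjI allI impI)
qed

lemma lambda_set_extension:
  assumes "lambda_set X"
  shows "\<exists>Y :: (nat \<Rightarrow> bool) set set set topology.
    first_countable Y \<and> pseudocompact_space Y \<and> embeds_densely (pr X) Y"
proof -
  define L where "L A = range (\<lambda>n. pr_basic A (X \<inter> nb n A))" for A
  interpret decisive_base "pr X" L
  proof
    show "Hausdorff_space (pr X)" by (rule Hausdorff_pr)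
  next
    fix A R assume A: "A \<in> topspace (pr X)" and "R \<in> L A"
    then obtain n where R: "R = pr_basic A (X \<inter> nb n A)" by (auto simp: L_def)
    have A: "finite A" "A \<subseteq> X" using A by (simp_all add: topspace_pr)
    show "openin (pr X) R" unfolding R by (rule openin_pr_basic[OF A openin_nb_Int])
    show "closedin (pr X) R" unfolding R by (rule closedin_pr_basic[OF A openin_nb_Int])
    show "A \<in> R" unfolding R pr_basic_def using A nb_superset by simp
  next
    fix W A assume W: "openin (pr X) W" "A \<in> W"
    obtain n where "pr_basic A (X \<inter> nb n A) \<subseteq> W"
      using eventually_happens'[OF sequentially_bot pr_base[OF W]] by (elim exE)
    then show "\<exists>R\<in>L A. R \<subseteq> W" unfolding L_def by (intro bexI) auto
  next
    fix V assume V: "\<And>k::nat. openin (pr X) (V k) \<and> V k \<noteq> {}"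
    obtain k :: "nat \<Rightarrow> nat" and r where k: "strict_mono k"
      and r: "\<forall>i. (\<exists>A n. finite A \<and> A \<subseteq> X \<and> r i = pr_basic A (X \<inter> nb n A)) \<and> r i \<subseteq> V (k i)"
      and dec: "\<forall>D n. finite D \<longrightarrow> D \<subseteq> X \<longrightarrow>
        (\<forall>\<^sub>F i in sequentially. r i \<subseteq> pr_basic D (X \<inter> nb n D)) \<or>
        (\<forall>\<^sub>F i in sequentially. r i \<inter> pr_basic D (X \<inter> nb n D) = {})"
      using pr_refine[OF assms, of V, OF V] by (elim exE conjE)
    have base: "\<Union>(L ` topspace (pr X)) = {pr_basic A (X \<inter> nb n A) | A n. finite A \<and> A \<subseteq> X}"
      by (auto simp: L_def topspace_pr)
    show "\<exists>k r. strict_mono (k :: nat \<Rightarrow> nat) \<and>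
        (\<forall>i. r i \<in> \<Union>(L ` topspace (pr X)) \<and> r i \<subseteq> V (k i)) \<and>
        (\<forall>R\<in>\<Union>(L ` topspace (pr X)). (\<forall>\<^sub>F i in sequentially. r i \<subseteq> R) \<or>
                                     (\<forall>\<^sub>F i in sequentially. r i \<inter> R = {}))"
    proof (intro exI[of _ k] exI[of _ r] conjI k allI ballI)
      show "r i \<subseteq> V (k i)" for i using r by simp
      show "r i \<in> \<Union>(L ` topspace (pr X))" for i
      proof -
        obtain A n where "finite A" "A \<subseteq> X" "r i = pr_basic A (X \<inter> nb n A)"
          using conjunct1[OF spec[OF r, of i]] by (elim exE conjE)
        then show ?thesis unfolding base by (intro CollectI exI conjI)
      qed
      fix R assume "R \<in> \<Union>(L ` topspace (pr X))"
      then obtain D n where D: "finite D" "D \<subseteq> X" "R = pr_basic D (X \<inter> nb n D)"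
        unfolding base by (elim CollectE exE conjE)
      show "(\<forall>\<^sub>F i in sequentially. r i \<subseteq> R) \<or> (\<forall>\<^sub>F i in sequentially. r i \<inter> R = {})"
        unfolding D(3) using dec D(1,2) by simp
    qed
  qed (simp add: L_def)
  show ?thesis by (rule first_countable_pseudocompact_extension)
qed

section \<open>Traces of first-countable pseudocompact extensions\<close>

text \<open>Without a cluster point the \<open>V k\<close> are locally finite, and summing bumps of
  height \<open>k\<close> that vanish outside \<open>V k\<close> gives an unbounded continuous
  function.\<close>

lemma pseudocompact_cluster:
  assumes Y: "pseudocompact_space Y"
    and V: "\<And>k::nat. openin Y (V k)" "\<And>k. V k \<noteq> {}"
  shows "\<exists>y\<in>topspace Y. \<forall>W. openin Y W \<longrightarrow> y \<in> W \<longrightarrow> (\<exists>\<^sub>F k in sequentially. W \<inter> V k \<noteq> {})"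
proof (rule ccontr)
  assume "\<not> ?thesis"
  then have fin: "\<exists>W. openin Y W \<and> y \<in> W \<and> (\<forall>\<^sub>F k in sequentially. W \<inter> V k = {})"
    if "y \<in> topspace Y" for y
    using that by (simp add: frequently_def)
  have "\<forall>k. \<exists>x. x \<in> V k" using V(2) by (simp add: ex_in_conv)
  then obtain p where p: "\<And>k. p k \<in> V k" by metis
  have ptop: "p k \<in> topspace Y" for k using p V(1) openin_subset by blast
  have cr: "completely_regular_space Y"
    using Y by (simp add: pseudocompact_space_def tychonoff_space_def)
  have "\<exists>f. continuous_map Y (top_of_set {0..1::real}) f \<and> f (p k) = 0 \<and>
      f ` (topspace Y - V k) \<subseteq> {1}" for k
  proof -
    have "closedin Y (topspace Y - V k)" using V(1) by blast
    then show ?thesis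
      using cr[unfolded completely_regular_space_def, rule_format, of "topspace Y - V k" "p k"]
        p ptop by simp
  qed
  then obtain f where f: "\<And>k. continuous_map Y (top_of_set {0..1::real}) (f k)"
      "\<And>k. f k (p k) = 0" "\<And>k. f k ` (topspace Y - V k) \<subseteq> {1}"
    by metis
  have f_cont: "continuous_map Y euclideanreal (f k)" for k
    using f(1) by (simp add: continuous_map_in_subtopology)
  have f_le: "f k y \<le> 1" if "y \<in> topspace Y" for k y
    using f(1)[of k] that by (auto simp: continuous_map_in_subtopology)
  have f_out: "f k y = 1" if "y \<in> topspace Y" "y \<notin> V k" for k y
    using f(3)[of k] that by auto
  \<comment> \<open>\<open>f k\<close> is 0 at \<open>p k\<close> and 1 off \<open>V k\<close>, so
    the \<open>k\<close>-th term is the bump; near each point the series is a finite sum.\<close>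
  define h where "h y = (\<Sum>k. real k * (1 - f k y))" for y
  have h: "h y = (\<Sum>k<n. real k * (1 - f k y))"
    if "y \<in> topspace Y" "\<And>k. k \<ge> n \<Longrightarrow> y \<notin> V k" for y n
    unfolding h_def using that f_out by (intro suminf_finite) auto
  define I where "I = {W. openin Y W \<and> (\<forall>\<^sub>F k in sequentially. W \<inter> V k = {})}"
  have "continuous_map Y euclideanreal h"
  proof (rule pasting_lemma[where I = I and T = id and f = "\<lambda>_. h"])
    fix W assume W: "W \<in> I"
    then show "openin Y (id W)" by (simp add: I_def)
    obtain n where n: "\<And>k. k \<ge> n \<Longrightarrow> W \<inter> V k = {}"
      using W by (auto simp: I_def eventually_sequentially)
    have "continuous_map (subtopology Y W) euclideanreal (\<lambda>y. \<Sum>k<n. real k * (1 - f k y))"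
      by (intro continuous_intros continuous_map_from_subtopology f_cont) auto
    then show "continuous_map (subtopology Y (id W)) euclideanreal h"
      unfolding id_def
    proof (rule continuous_map_eq)
      fix y assume "y \<in> topspace (subtopology Y W)"
      then show "(\<Sum>k<n. real k * (1 - f k y)) = h y"
        using n by (intro h[symmetric]) auto
    qed
  next
    fix y assume "y \<in> topspace Y"
    then show "\<exists>j. j \<in> I \<and> y \<in> id j \<and> h y = h y"
      using fin[of y] by (auto simp: I_def)
  qed simp
  then have "bounded (h ` topspace Y)" using Y by (simp add: pseudocompact_space_def)
  then obtain B where B: "\<And>y. y \<in> topspace Y \<Longrightarrow> \<bar>h y\<bar> \<le> B"
    unfolding bounded_iff by auto
  obtain k where k: "real k > B" using reals_Archimedean2 by blast
  obtain W n where W: "p k \<in> W" "\<And>j. j \<ge> n \<Longrightarrow> W \<inter> V j = {}"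
    using fin[OF ptop, of k] by (auto simp: eventually_sequentially)
  have "k < n" using W p[of k] by (metis IntI empty_iff linorder_not_le)
  have "real k * (1 - f k (p k)) \<le> (\<Sum>j<n. real j * (1 - f j (p k)))"
    using \<open>k < n\<close> f_le[OF ptop] by (intro member_le_sum) auto
  also have "\<dots> = h (p k)"
    using W ptop by (intro h[symmetric]) auto
  finally show False using B[OF ptop, of k] k f(2)[of k] by simp
qed

lemma first_countable_decreasing_base:
  assumes "first_countable Y" "y \<in> topspace Y"
  obtains W :: "nat \<Rightarrow> 'b set" where "\<And>k. openin Y (W k)" "\<And>k. y \<in> W k"
    "\<And>U. openin Y U \<Longrightarrow> y \<in> U \<Longrightarrow> \<forall>\<^sub>F k in sequentially. W k \<subseteq> U"
proof -
  obtain \<B> where \<B>: "countable \<B>" "\<And>V. V \<in> \<B> \<Longrightarrow> openin Y V"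
      "\<And>U. openin Y U \<Longrightarrow> y \<in> U \<Longrightarrow> \<exists>V\<in>\<B>. y \<in> V \<and> V \<subseteq> U"
    using assms unfolding first_countable_def by metis
  define \<C> where "\<C> = {V \<in> \<B>. y \<in> V}"
  have "\<C> \<noteq> {}" using \<B>(3)[OF openin_topspace assms(2)] by (auto simp: \<C>_def)
  have "countable \<C>" using \<B>(1) by (simp add: \<C>_def)
  define W where "W k = \<Inter>(from_nat_into \<C> ` {..k})" for k
  have mem: "from_nat_into \<C> i \<in> \<C>" for i using \<open>\<C> \<noteq> {}\<close> by (rule from_nat_into)
  show thesis
  proof
    show "openin Y (W k)" for k
      unfolding W_def using mem \<B>(2) by (intro openin_Inter) (auto simp: \<C>_def)
    show "y \<in> W k" for k using mem by (auto simp: W_def \<C>_def)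
    fix U assume "openin Y U" "y \<in> U"
    then obtain V where V: "V \<in> \<C>" "V \<subseteq> U" using \<B>(3) by (auto simp: \<C>_def)
    then obtain i where i: "V = from_nat_into \<C> i"
      using from_nat_into_surj[OF \<open>countable \<C>\<close>] by metis
    show "\<forall>\<^sub>F k in sequentially. W k \<subseteq> U"
      using eventually_ge_at_top[of i]
    proof eventually_elim
      case (elim k)
      then have "W k \<subseteq> V" unfolding W_def i by (intro INF_lower) simp
      then show ?case using V(2) by simp
    qed
  qed
qed

section \<open>Recovering the \<lambda>-set property\<close>

locale pr_extension =
  fixes X :: "(nat \<Rightarrow> bool) set" and Y :: "'b topology" and e :: "(nat \<Rightarrow> bool) set \<Rightarrow> 'b"
  assumes first_countable: "first_countable Y"
    and pseudocompact: "pseudocompact_space Y"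
    and embedding: "embedding_map (pr X) Y e"
    and dense: "Y closure_of (e ` topspace (pr X)) = topspace Y"
begin

definition img :: "'b set" where "img = e ` topspace (pr X)"

lemma inj_e: "inj_on e (topspace (pr X))"
  using embedding by (simp add: embedding_map_def homeomorphic_map_def)

lemma open_preimage:
  assumes "openin Y Q" shows "openin (pr X) {A \<in> topspace (pr X). e A \<in> Q}"
proof -
  have "continuous_map (pr X) (subtopology Y (e ` topspace (pr X))) e"
    using embedding unfolding embedding_map_def by (rule homeomorphic_imp_continuous_map)
  then have "continuous_map (pr X) Y e" by (simp add: continuous_map_in_subtopology)
  then show ?thesis using assms by (rule openin_continuous_map_preimage)
qed

lemma open_trace:
  assumes "openin (pr X) W" shows "\<exists>Q. openin Y Q \<and> Q \<inter> img = e ` W"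
proof -
  have "open_map (pr X) (subtopology Y img) e"
    using embedding unfolding embedding_map_def img_def by (rule homeomorphic_imp_open_map)
  then have "openin (subtopology Y img) (e ` W)" using assms by (simp add: open_map_def)
  then show ?thesis by (auto simp: openin_subtopology)
qed

text \<open>A form of regularity of \<open>Y\<close> at \<open>e {x}\<close>: any point of
  \<open>Y\<close> in the closure has the neighbourhood \<open>Q\<close>, whose trace on the
  hyperspace consists of sets containing \<open>x\<close>.\<close>

definition scale :: "(nat \<Rightarrow> bool) \<Rightarrow> nat \<Rightarrow> bool"
  where "scale x n \<longleftrightarrow> (\<exists>Q. openin Y Q \<and> Q \<inter> img = e ` pr_basic {x} X \<and>
    Y closure_of (e ` pr_basic {x} (X \<inter> cyl n x)) \<subseteq> Q)"

lemma scale_exists: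
  assumes "x \<in> X" shows "\<exists>n. scale x n"
proof -
  have "openin (pr X) (pr_basic {x} X)"
    using assms by (intro openin_pr_basic openin_self) auto
  then obtain Q where Q: "openin Y Q" "Q \<inter> img = e ` pr_basic {x} X" using open_trace by metis
  have x: "{x} \<in> topspace (pr X)" "{x} \<in> pr_basic {x} X"
    using assms by (auto simp: topspace_pr pr_basic_def)
  then have "e {x} \<in> Q" using Q(2) by blast
  moreover have "regular_space Y"
    using pseudocompact unfolding pseudocompact_space_def tychonoff_space_def
    by (intro completely_regular_imp_regular_space) simp
  ultimately obtain U C where U: "openin Y U" "closedin Y C" "e {x} \<in> U" "U \<subseteq> C" "C \<subseteq> Q"
    using Q(1) by (metis neighbourhood_base_of neighbourhood_base_of_closedin)
  have *: "\<forall>\<^sub>F n in sequentially. pr_basic {x} (X \<inter> cyl n x) \<subseteq> {A \<in> topspace (pr X). e A \<in> U}"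
    using x(1) U(3) by (intro pr_base open_preimage U(1)) simp
  obtain n where n: "pr_basic {x} (X \<inter> cyl n x) \<subseteq> {A \<in> topspace (pr X). e A \<in> U}"
    using eventually_happens'[OF sequentially_bot *] by (elim exE)
  then have "e ` pr_basic {x} (X \<inter> cyl n x) \<subseteq> C" using U(4) by auto
  then have "Y closure_of (e ` pr_basic {x} (X \<inter> cyl n x)) \<subseteq> C"
    using U(2) by (rule closure_of_minimal)
  then have "Y closure_of (e ` pr_basic {x} (X \<inter> cyl n x)) \<subseteq> Q" using U(5) by (rule subset_trans)
  with Q have "scale x n" unfolding scale_def by (intro exI conjI)
  then show ?thesis by (rule exI)
qed

text \<open>Density lets a neighbourhood of \<open>y\<close> that meets an open extension of
  \<open>V j\<close> reach a point of \<open>V j\<close> itself; since the \<open>V k\<close>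
  decrease, clustering becomes a statement about every \<open>k\<close>.\<close>

lemma pr_cluster:
  assumes V: "\<And>k::nat. openin (pr X) (V k)" "\<And>k. V k \<noteq> {}" "\<And>k. V (Suc k) \<subseteq> V k"
  obtains y where "y \<in> topspace Y"
    "\<And>k W. openin Y W \<Longrightarrow> y \<in> W \<Longrightarrow> \<exists>A\<in>V k. e A \<in> W"
proof -
  have "\<forall>k. \<exists>Q. openin Y Q \<and> Q \<inter> img = e ` V k" using open_trace V(1) by simp
  then obtain Q where Q: "\<And>k. openin Y (Q k)" "\<And>k. Q k \<inter> img = e ` V k" by metis
  have ne: "Q k \<noteq> {}" for k using Q(2)[of k] V(2)[of k] by auto
  obtain y where y: "y \<in> topspace Y"
      "\<forall>W. openin Y W \<longrightarrow> y \<in> W \<longrightarrow> (\<exists>\<^sub>F k in sequentially. W \<inter> Q k \<noteq> {})"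
    using pseudocompact_cluster[of Y Q, OF pseudocompact Q(1) ne] by (elim bexE)
  show thesis
  proof
    show "y \<in> topspace Y" by (rule y(1))
    fix k W assume W: "openin Y W" "y \<in> W"
    obtain j where j: "j \<ge> k" "W \<inter> Q j \<noteq> {}"
      using y(2)[rule_format, OF W] unfolding frequently_sequentially by metis
    have "openin Y (W \<inter> Q j)" using W Q(1) by blast
    with j(2) have "img \<inter> (W \<inter> Q j) \<noteq> {}"
      using dense unfolding dense_intersects_open img_def[symmetric] by metis
    then obtain z where "z \<in> W" "z \<in> Q j \<inter> img" by blast
    then obtain A where "A \<in> V j" "e A \<in> W" using Q(2) by auto
    moreover have "V j \<subseteq> V k" using V(3) j(1) by (rule lift_Suc_antimono_le)
    ultimately show "\<exists>A\<in>V k. e A \<in> W" by blast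
  qed
qed

text \<open>With \<open>A\<^sub>k \<supseteq> {c\<^sub>0, \<dots>, c\<^sub>k}\<close> and \<open>[A\<^sub>k, U\<^sub>k]\<close> inside the \<open>k\<close>-th neighbourhood of the cluster point
  \<open>y\<close>, the set \<open>G\<close> is the upper limit of the \<open>U\<^sub>k\<close> minus the countable set \<open>\<Union>\<^sub>k A\<^sub>k - C\<close>. If some
  \<open>x \<in> G - C\<close> had level \<open>n\<close>, the points \<open>A\<^sub>k \<union> {x}\<close> would put \<open>y\<close> into the open set belonging to \<open>x\<close>,
  hence \<open>x \<in> A\<^sub>k\<close> for some \<open>k\<close>.\<close>
lemma local_separation:
  assumes C: "C \<subseteq> X" "countable C"
  shows "\<exists>G. gdelta_in (subtopology cantor_space X) G \<and> C \<inter> cyl n a \<subseteq> G \<and>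
    (\<forall>x\<in>G. x \<in> cyl n a \<longrightarrow> scale x n \<longrightarrow> x \<in> C)"
proof (cases "C \<inter> cyl n a = {}")
  case True
  then show ?thesis by (intro exI[of _ "{}"]) simp
next
  case False
  \<comment> \<open>The enumeration may repeat, so finite intersections are covered; the empty one
    was split off because it has no enumeration.\<close>
  define c where "c = from_nat_into (C \<inter> cyl n a)"
  have c: "c i \<in> C" "c i \<in> cyl n a" for i
    using from_nat_into[OF False, of i] by (simp_all add: c_def)
  have c_surj: "\<exists>i. c i = x" if "x \<in> C \<inter> cyl n a" for x
    unfolding c_def using C(2) that by (intro from_nat_into_surj) auto
  define V where "V k = pr_basic (c ` {..k}) (X \<inter> cyl n a)" for k
  have V_open: "openin (pr X) (V k)" for k
    unfolding V_def using c(1) C(1) by (intro openin_pr_basic openin_nb_Int) auto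
  have V_ne: "V k \<noteq> {}" for k
  proof -
    have "c ` {..k} \<in> V k" using c C(1) by (auto simp: V_def pr_basic_def)
    then show ?thesis by auto
  qed
  have V_dec: "V (Suc k) \<subseteq> V k" for k
    unfolding V_def by (intro pr_basic_mono image_mono) auto
  obtain y where y: "y \<in> topspace Y" "\<And>k W. openin Y W \<Longrightarrow> y \<in> W \<Longrightarrow> \<exists>A\<in>V k. e A \<in> W"
    using pr_cluster[of V, OF V_open V_ne V_dec] by metis
  obtain W where W: "\<And>k. openin Y (W k)" "\<And>k. y \<in> W k"
    "\<And>U. openin Y U \<Longrightarrow> y \<in> U \<Longrightarrow> \<forall>\<^sub>F k in sequentially. W k \<subseteq> U"
    using first_countable_decreasing_base[OF first_countable y(1)] by metis
  have "\<exists>A m. A \<in> V k \<and> pr_basic A (X \<inter> nb m A) \<subseteq> {A \<in> topspace (pr X). e A \<in> W k}" for k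
  proof -
    obtain A where A: "A \<in> V k" "e A \<in> W k" using y(2)[OF W(1,2)] by metis
    have "A \<in> topspace (pr X)" using openin_subset[OF V_open] A(1) by blast
    then have "\<forall>\<^sub>F m in sequentially. pr_basic A (X \<inter> nb m A) \<subseteq> {A \<in> topspace (pr X). e A \<in> W k}"
      using A(2) by (intro pr_base open_preimage W(1)) simp
    from eventually_happens'[OF sequentially_bot this]
    obtain m where "pr_basic A (X \<inter> nb m A) \<subseteq> {A \<in> topspace (pr X). e A \<in> W k}" by (elim exE)
    with A(1) show ?thesis by (intro exI conjI)
  qed
  then have "\<forall>k. \<exists>A m. A \<in> V k \<and> pr_basic A (X \<inter> nb m A) \<subseteq> {A \<in> topspace (pr X). e A \<in> W k}"
    by (rule allI)
  from choice[OF this] obtain A where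
    "\<forall>k. \<exists>m. A k \<in> V k \<and> pr_basic (A k) (X \<inter> nb m (A k)) \<subseteq> {A \<in> topspace (pr X). e A \<in> W k}"
    by (elim exE)
  from choice[OF this] obtain m where
    "\<forall>k. A k \<in> V k \<and> pr_basic (A k) (X \<inter> nb (m k) (A k)) \<subseteq> {A \<in> topspace (pr X). e A \<in> W k}"
    by (elim exE)
  then have A: "A k \<in> V k"
    and Am: "pr_basic (A k) (X \<inter> nb (m k) (A k)) \<subseteq> {A \<in> topspace (pr X). e A \<in> W k}" for k
    by simp_all
  have A_fin: "finite (A k)" and A_c: "c ` {..k} \<subseteq> A k" and A_sub: "A k \<subseteq> X \<inter> cyl n a" for k
    using A[of k] by (simp_all add: V_def pr_basic_def)
  define U where "U k = X \<inter> nb (m k) (A k)" for k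
  have A_U: "A k \<subseteq> U k" for k using A_sub nb_superset unfolding U_def by blast
  have mem_W: "e B \<in> W k" if "finite B" "A k \<subseteq> B" "B \<subseteq> U k" for B k
    using Am[of k] that by (auto simp: pr_basic_def U_def)
  \<comment> \<open>An upper limit of open sets is a G-delta, and the removed set is countable,
    hence F-sigma in \<open>X\<close>. Its removal secures \<open>x \<notin> A k\<close> for the
    final contradiction.\<close>
  define G where "G = (\<Inter>i. \<Union>k\<in>{i..}. U k) - ((\<Union>k. A k) - C)"
  have "gdelta_in (subtopology cantor_space X) G"
    unfolding G_def
  proof (rule gdelta_in_diff)
    show "gdelta_in (subtopology cantor_space X) (\<Inter>i. \<Union>k\<in>{i..}. U k)"
    proof (rule gdelta_in_Inter)
      fix S assume "S \<in> range (\<lambda>i. \<Union>k\<in>{i..}. U k)"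
      then obtain i where S: "S = (\<Union>k\<in>{i..}. U k)" by auto
      have "openin (subtopology cantor_space X) (U k)" for k
        unfolding U_def by (rule openin_nb_Int)
      then show "gdelta_in (subtopology cantor_space X) S"
        unfolding S by (intro open_imp_gdelta_in openin_Union) auto
    qed simp_all
    have "countable ((\<Union>k. A k) - C)" using A_fin by (intro countable_Diff) (simp add: countable_finite)
    moreover have "closedin (subtopology cantor_space X) {x}" if "x \<in> X" for x
      using openin_remove_point[OF openin_self, of X x] that by (simp add: closedin_def)
    moreover have "(\<Union>k. A k) - C \<subseteq> X" using A_sub by blast
    ultimately have "fsigma_in (subtopology cantor_space X) (\<Union>((\<lambda>x. {x}) ` ((\<Union>k. A k) - C)))"
      by (intro fsigma_in_Union) (auto intro: closed_imp_fsigma_in)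
    then show "fsigma_in (subtopology cantor_space X) ((\<Union>k. A k) - C)" by simp
  qed
  moreover have "C \<inter> cyl n a \<subseteq> G"
  proof
    fix x assume x: "x \<in> C \<inter> cyl n a"
    then obtain i where i: "c i = x" using c_surj by blast
    have "x \<in> U k" if "k \<ge> i" for k
      using A_c[of k] A_U[of k] that i by auto
    then have "x \<in> (\<Union>k\<in>{j..}. U k)" for j
      by (intro UN_I[of "max i j"]) auto
    then show "x \<in> G" using x by (simp add: G_def)
  qed
  moreover have "x \<in> C" if x: "x \<in> G" "x \<in> cyl n a" "scale x n" for x
  proof (rule ccontr)
    assume "x \<notin> C"
    then have xA: "x \<notin> A k" for k using x(1) by (auto simp: G_def)
    have xU: "\<exists>k\<ge>i. x \<in> U k" for i using x(1) by (auto simp: G_def)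
    have cyl: "cyl n x = cyl n a" using x(2) by (rule cyl_eq)
    obtain Q where Q: "openin Y Q" "Q \<inter> img = e ` pr_basic {x} X"
      "Y closure_of (e ` pr_basic {x} (X \<inter> cyl n a)) \<subseteq> Q"
      using x(3) unfolding scale_def cyl by metis
    have "y \<in> Y closure_of (e ` pr_basic {x} (X \<inter> cyl n a))"
      unfolding in_closure_of
    proof (intro conjI y(1) allI impI)
      fix T assume T: "y \<in> T \<and> openin Y T"
      obtain i where i: "\<And>k. k \<ge> i \<Longrightarrow> W k \<subseteq> T"
        using W(3)[of T] T by (auto simp: eventually_sequentially)
      obtain k where k: "k \<ge> i" "x \<in> U k" using xU by metis
      have "insert x (A k) \<in> pr_basic {x} (X \<inter> cyl n a)"
        using A_fin[of k] A_sub[of k] k(2) x(2) by (auto simp: pr_basic_def U_def)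
      moreover have "e (insert x (A k)) \<in> W k"
        using A_fin[of k] A_U[of k] k(2) by (intro mem_W) auto
      ultimately show "\<exists>z. z \<in> e ` pr_basic {x} (X \<inter> cyl n a) \<and> z \<in> T"
        using i[OF k(1)] by (intro exI[of _ "e (insert x (A k))"] conjI) auto
    qed
    then have "y \<in> Q" using Q(3) by (rule subsetD[rotated])
    from eventually_happens'[OF sequentially_bot W(3)[OF Q(1) this]]
    obtain k where k: "W k \<subseteq> Q" by (elim exE)
    have Ak: "A k \<in> topspace (pr X)" using A_fin[of k] A_sub[of k] by (simp add: topspace_pr)
    \<comment> \<open>The set \<open>A k\<close> omits \<open>x\<close>, yet its image lies in
      \<open>Q\<close>, whose trace consists of sets containing \<open>x\<close>.\<close>
    have "e (A k) \<in> W k" using A_fin A_U by (intro mem_W) auto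
    then have "e (A k) \<in> Q \<inter> img" using k Ak by (auto simp: img_def)
    then obtain B where B: "B \<in> pr_basic {x} X" "e (A k) = e B" unfolding Q(2) by auto
    then have "B \<in> topspace (pr X)" by (simp add: pr_basic_def topspace_pr)
    then have "A k = B" using inj_onD[OF inj_e B(2) Ak] by simp
    then show False using xA[of k] B(1) by (simp add: pr_basic_def)
  qed
  ultimately show ?thesis by (intro exI[of _ G]) simp
qed

text \<open>Intersecting the local separations over all levels and cylinders leaves exactly
  \<open>C\<close>: each point of \<open>X\<close> has some level \<open>n\<close>, and the
  separation for its cylinder of level \<open>n\<close> excludes it unless it is in
  \<open>C\<close>.\<close>

lemma lambda_set: "lambda_set X"
  unfolding lambda_set_def
proof (intro allI impI)
  fix C assume "C \<subseteq> X \<and> countable C"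
  then have C: "C \<subseteq> X" "countable C" by simp_all
  \<comment> \<open>Cylinders are indexed as sets, of which there are only countably many, rather
    than by their centres.\<close>
  define J where "J = (UNIV :: nat set) \<times> {nb n A | n A. finite A}"
  have J: "countable J" unfolding J_def using countable_nbs by (intro countable_SIGMA) auto
  define sep where "sep j G \<longleftrightarrow> gdelta_in (subtopology cantor_space X) G \<and> C \<inter> snd j \<subseteq> G \<and>
    (\<forall>x\<in>G. x \<in> snd j \<longrightarrow> scale x (fst j) \<longrightarrow> x \<in> C)" for j G
  define K where "K = {j \<in> J. \<exists>n a. j = (n, cyl n a)}"
  have K: "countable K" unfolding K_def using J by simp
  have inK: "(n, cyl n a) \<in> K" for n a
    unfolding K_def J_def by auto
  have "\<exists>G. sep j G" if j: "j \<in> K" for j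
  proof -
    obtain n a where "j = (n, cyl n a)" using j by (auto simp: K_def)
    then show ?thesis using local_separation[OF C, of n a] by (simp add: sep_def)
  qed
  then obtain G where G: "\<And>j. j \<in> K \<Longrightarrow> sep j (G j)" by metis
  \<comment> \<open>Off the cylinder of \<open>j\<close> no condition is imposed, so
    \<open>C \<subseteq> H j\<close>; the added set is open in \<open>X\<close> because cylinders
    are closed.\<close>
  define H where "H j = G j \<union> (X \<inter> - snd j)" for j
  have "gdelta_in (subtopology cantor_space X) (\<Inter>(H ` K))"
  proof (rule gdelta_in_Inter)
    show "countable (H ` K)" using K by simp
    show "H ` K \<noteq> {}" using inK by auto
    fix S assume "S \<in> H ` K"
    then obtain j where j: "j \<in> K" "S = H j" by auto
    then obtain n a where na: "snd j = cyl n a" by (auto simp: K_def)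
    have "openin cantor_space (- cyl n a)"
      using closedin_nb[of n "{a}"] by (simp add: closedin_def Compl_eq_Diff_UNIV)
    then have "openin (subtopology cantor_space X) (X \<inter> - snd j)"
      unfolding na by (auto simp: openin_subtopology)
    moreover have "gdelta_in (subtopology cantor_space X) (G j)"
      using G[OF j(1)] by (simp add: sep_def)
    ultimately show "gdelta_in (subtopology cantor_space X) S"
      unfolding j(2) H_def by (intro gdelta_in_Un[OF _ open_imp_gdelta_in])
  qed
  moreover have "\<Inter>(H ` K) = C"
  proof
    show "C \<subseteq> \<Inter>(H ` K)"
      using G C(1) unfolding sep_def H_def by blast
    show "\<Inter>(H ` K) \<subseteq> C"
    proof
      fix x assume x: "x \<in> \<Inter>(H ` K)"
      then have sub: "x \<in> G (n, cyl n x)" for n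
        using inK[of n x] nb_superset[of "{x}" n] by (auto simp: H_def)
      have "G (0, cyl 0 x) \<subseteq> X"
        using gdelta_in_subset[of "subtopology cantor_space X"] G[OF inK] by (fastforce simp: sep_def)
      then have "x \<in> X" using sub by blast
      then obtain n where "scale x n" using scale_exists by blast
      then show "x \<in> C"
        using G[OF inK, of n x] sub[of n] nb_superset[of "{x}" n] by (auto simp: sep_def)
    qed
  qed
  ultimately show "gdelta_in (subtopology cantor_space X) C" by simp
qed

end

lemma lambda_set_if_extension:
  assumes "\<exists>Y :: 'b topology. first_countable Y \<and> pseudocompact_space Y \<and> embeds_densely (pr X) Y"
  shows "lambda_set X"
proof -
  obtain Y :: "'b topology" and e where "pr_extension X Y e"
    using assms by (auto simp: embeds_densely_def pr_extension_def)
  then show ?thesis by (rule pr_extension.lambda_set)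
qed

theorem theorem3p10:
  fixes X :: "(nat \<Rightarrow> bool) set"
  shows "(lambda_set X \<longleftrightarrow>
            (\<exists>Y :: (nat \<Rightarrow> bool) set set set topology.
               first_countable Y \<and> pseudocompact_space Y \<and>
               embeds_densely (pixley_roy (subtopology cantor_space X)) Y))
       \<and> ((\<exists>Y :: 'b topology.
               first_countable Y \<and> pseudocompact_space Y \<and>
               embeds_densely (pixley_roy (subtopology cantor_space X)) Y)
            \<longrightarrow> lambda_set X)"
  using lambda_set_extension[of X] lambda_set_if_extension[of X] by metis

end
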